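(* Let $(Z_k)_{k\in\mathbb Z}$ be a stationary and ergodic process with values in $G=\mathbb C\rtimes S^1$, and set $S_n=Z_{n-1}\cdots Z_1\cdot Z_0$ for $n\ge1$. Let $\pi_{\mathbb C}:\mathbb C\rtimes S^1\to\mathbb C$ denote the projection onto $\mathbb C$. If there exists a constant $c>0$ such that $$\liminf_{n\to\infty}P\big[n^{-1/2}|\pi_{\mathbb C}(S_n)|\le\eta\big]\ge c\,\eta^2\quad\text{for all }\eta\in(0,1),$$ then the random walk $(S_n)_{n\ge1}$ is recurrent.
   Context: Group: $G=\mathbb C\rtimes S^1=\{(z,e^{i\gamma}):z\in\mathbb C,\gamma\in[0,2\pi)\}$ carries the product topology and the group operation $(z_2,e^{i\gamma_2})\cdot(z_1,e^{i\gamma_1})=(z_2+e^{i\gamma_2}z_1,e^{i(\gamma_2+\gamma_1)})$, with identity $1_G=(0,1)$; $\pi_{\mathbb C}(z,e^{i\gamma})=z$. Recurrence: a stationary $G$-valued process $(Z_k)_{k\in\mathbb Z}$ is realized as $Z_k=f\circ T^k$, where $T$ is an invertible probability-preserving transformation of a standard probability space $(X,\mathfrak B,\mu)$ (for instance the shift on the canonical path space) and $f:X\to G$ is Borel. Define $\mathbf f(n,x)=f(T^{n-1}x)\cdots f(Tx)f(x)$ for $n\ge1$, $\mathbf f(0,x)=1_G$, $\mathbf f(n,x)=\mathbf f(-n,T^nx)^{-1}$ for $n<0$. The random walk $Z_{n-1}\cdots Z_0=\mathbf f(n,\cdot)$ is recurrent if for every measurable $B$ with $\mu(B)>0$ and every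 open neighbourhood $U$ of $1_G$ there is an integer $n\ne0$ with $\mu(B\cap T^{-n}B\cap\{x:\mathbf f(n,x)\in U\})>0$. *)

theory Defs
  imports "HOL-Probability.Probability" "HOL-Algebra.Group"
begin

section \<open>The group \<open>\<complex> \<rtimes> S\<^sup>1\<close>\<close>

text \<open>The pair \<open>(z, w)\<close> with \<open>|w| = 1\<close> stands for \<open>(z, e\<^bsup>i\<gamma>\<^esup>)\<close> with \<open>w = e\<^bsup>i\<gamma>\<^esup>\<close>; the projection
  to \<open>\<complex>\<close> is \<^const>\<open>fst\<close>. The product topology is the subspace topology inherited from \<open>\<complex> \<times> \<complex>\<close>.\<close>

definition motion_group :: "(complex \<times> complex) monoid" where
  "motion_group =
     \<lparr>carrier = UNIV \<times> sphere 0 1,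
      mult = (\<lambda>(z2, w2) (z1, w1). (z2 + w2 * z1, w2 * w1)),
      one = (0, 1)\<rparr>"

abbreviation motion_top :: "(complex \<times> complex) topology" where
  "motion_top \<equiv> top_of_set (carrier motion_group)"

abbreviation motion_borel :: "(complex \<times> complex) measure" where
  "motion_borel \<equiv> restrict_space borel (carrier motion_group)"

lemma group_motion_group: "group motion_group"
proof (rule groupI)
  fix x assume x: "x \<in> carrier motion_group"
  obtain z w where [simp]: "x = (z, w)" by (cases x)
  have w: "norm w = 1" using x by (simp add: motion_group_def)
  hence "w \<noteq> 0" by auto
  hence "(- (z / w), inverse w) \<otimes>\<^bsub>motion_group\<^esub> x = \<one>\<^bsub>motion_group\<^esub>"
    by (simp add: motion_group_def field_simps)
  moreover have "(- (z / w), inverse w) \<in> carrier motion_group"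
    using w by (simp add: motion_group_def norm_inverse)
  ultimately show "\<exists>y\<in>carrier motion_group. y \<otimes>\<^bsub>motion_group\<^esub> x = \<one>\<^bsub>motion_group\<^esub>"
    by blast
qed (auto simp: motion_group_def norm_mult algebra_simps)

text \<open>\<open>walk z n = z\<^bsub>n-1\<^esub> \<cdots> z\<^bsub>1\<^esub> z\<^bsub>0\<^esub>\<close>, new factors entering on the left.\<close>

primrec walk :: "(nat \<Rightarrow> complex \<times> complex) \<Rightarrow> nat \<Rightarrow> complex \<times> complex" where
  "walk z 0 = \<one>\<^bsub>motion_group\<^esub>"
| "walk z (Suc n) = z n \<otimes>\<^bsub>motion_group\<^esub> walk z n"


section \<open>Stationary and ergodic processes indexed by the integers\<close>

abbreviation path_space :: "(int \<Rightarrow> complex \<times> complex) measure" where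
  "path_space \<equiv> (\<Pi>\<^sub>M k\<in>UNIV. motion_borel)"

definition path_shift :: "(int \<Rightarrow> 'b) \<Rightarrow> int \<Rightarrow> 'b" where
  "path_shift u = (\<lambda>k. u (k + 1))"

definition path_law :: "'a measure \<Rightarrow> (int \<Rightarrow> 'a \<Rightarrow> complex \<times> complex) \<Rightarrow> (int \<Rightarrow> complex \<times> complex) measure"
  where "path_law M Z = distr M path_space (\<lambda>\<omega> k. Z k \<omega>)"

definition motion_process :: "'a measure \<Rightarrow> (int \<Rightarrow> 'a \<Rightarrow> complex \<times> complex) \<Rightarrow> bool" where
  "motion_process M Z \<longleftrightarrow> prob_space M \<and> (\<forall>k. Z k \<in> measurable M motion_borel)"

definition stationary_process :: "'a measure \<Rightarrow> (int \<Rightarrow> 'a \<Rightarrow> complex \<times> complex) \<Rightarrow> bool" where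
  "stationary_process M Z \<longleftrightarrow> (\<forall>m. path_law M (\<lambda>k. Z (k + m)) = path_law M Z)"

text \<open>Ergodicity of the process is ergodicity of the shift under its law.\<close>

definition ergodic_process :: "'a measure \<Rightarrow> (int \<Rightarrow> 'a \<Rightarrow> complex \<times> complex) \<Rightarrow> bool" where
  "ergodic_process M Z \<longleftrightarrow>
     (\<forall>A\<in>sets path_space. path_shift -` A \<inter> space path_space = A \<longrightarrow>
        measure (path_law M Z) A \<in> {0, 1})"


section \<open>Realizations and recurrence\<close>

definition standard_probability_space :: "'a measure \<Rightarrow> bool" where
  "standard_probability_space M \<longleftrightarrow> prob_space M \<and>
     (\<exists>X. topspace X = space M \<and> completely_metrizable_space X \<and> second_countable X \<and>
          sets M = sigma_sets (topspace X) {U. openin X U})"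

definition invertible_mpt :: "'a measure \<Rightarrow> ('a \<Rightarrow> 'a) \<Rightarrow> bool" where
  "invertible_mpt M T \<longleftrightarrow>
     bij_betw T (space M) (space M) \<and> T \<in> measurable M M \<and>
     the_inv_into (space M) T \<in> measurable M M \<and> distr M M T = M"

definition int_iter :: "'a measure \<Rightarrow> ('a \<Rightarrow> 'a) \<Rightarrow> int \<Rightarrow> 'a \<Rightarrow> 'a" where
  "int_iter M T k = (if k \<ge> 0 then T ^^ nat k else the_inv_into (space M) T ^^ nat (- k))"

text \<open>\<open>(N, T, f)\<close> realizes the process \<open>Z\<close> if \<open>(f \<circ> T\<^sup>k)\<^sub>k\<close> has the same law as \<open>Z\<close>, so \<open>Z\<close> itself may live on
  another probability space. This covers \<open>Z\<^sub>k = f \<circ> T\<^sup>k\<close> on \<open>N\<close>, and the shift with the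
  coordinate map on path space (see \<open>realizes_path_shift\<close> below).\<close>

definition realizes ::
    "'b measure \<Rightarrow> ('b \<Rightarrow> 'b) \<Rightarrow> ('b \<Rightarrow> complex \<times> complex) \<Rightarrow>
     'a measure \<Rightarrow> (int \<Rightarrow> 'a \<Rightarrow> complex \<times> complex) \<Rightarrow> bool" where
  "realizes N T f M Z \<longleftrightarrow>
     standard_probability_space N \<and> invertible_mpt N T \<and> f \<in> measurable N motion_borel \<and>
     path_law N (\<lambda>k x. f (int_iter N T k x)) = path_law M Z"

definition cocycle ::
    "'a measure \<Rightarrow> ('a \<Rightarrow> 'a) \<Rightarrow> ('a \<Rightarrow> complex \<times> complex) \<Rightarrow> int \<Rightarrow> 'a \<Rightarrow> complex \<times> complex" where
  "cocycle M T f n x =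
     (if n \<ge> 0 then walk (\<lambda>k. f ((T ^^ k) x)) (nat n)
      else inv\<^bsub>motion_group\<^esub> (walk (\<lambda>k. f ((T ^^ k) (int_iter M T n x))) (nat (- n))))"

definition recurrent :: "'a measure \<Rightarrow> ('a \<Rightarrow> 'a) \<Rightarrow> ('a \<Rightarrow> complex \<times> complex) \<Rightarrow> bool" where
  "recurrent M T f \<longleftrightarrow>
     (\<forall>B\<in>sets M. measure M B > 0 \<longrightarrow>
        (\<forall>U. openin motion_top U \<and> \<one>\<^bsub>motion_group\<^esub> \<in> U \<longrightarrow>
           (\<exists>n::int. n \<noteq> 0 \<and>
              measure M {x \<in> space M. x \<in> B \<and> int_iter M T n x \<in> B \<and> cocycle M T f n x \<in> U} > 0)))"


section \<open>The canonical realization on path space\<close>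

lemma space_path_space: "space path_space = UNIV \<rightarrow>\<^sub>E carrier motion_group"
  by (simp add: space_PiM space_restrict_space)

lemma measurable_path_shift: "path_shift \<in> measurable path_space path_space"
  unfolding path_shift_def by (rule measurable_PiM_single') (auto simp: space_path_space space_restrict_space)

definition path_unshift :: "(int \<Rightarrow> 'b) \<Rightarrow> int \<Rightarrow> 'b" where
  "path_unshift u = (\<lambda>k. u (k - 1))"
lemma measurable_path_unshift: "path_unshift \<in> measurable path_space path_space"
  unfolding path_unshift_def by (rule measurable_PiM_single') (auto simp: space_path_space space_restrict_space)

lemma closed_motion_group: "closed (carrier motion_group)"
  by (simp add: motion_group_def closed_Times)

lemma sets_path_space:
  "sets path_space =
     sets (restrict_space (borel::(int \<Rightarrow> complex\<times>complex) measure) (UNIV \<rightarrow>\<^sub>E carrier motion_group))"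
proof -
  let ?C = "UNIV \<rightarrow>\<^sub>E carrier motion_group :: (int \<Rightarrow> complex\<times>complex) set"
  let ?B = "\<Pi>\<^sub>M i\<in>(UNIV::int set). (borel::(complex\<times>complex) measure)"
  let ?R = "restrict_space ?B ?C"
  have sR: "space ?R = ?C" by (auto simp: space_restrict_space space_PiM)
  have 1: "(\<lambda>x. x) \<in> measurable ?R path_space"
  proof (rule measurable_PiM_single')
    fix i :: int
    show "(\<lambda>x. x i) \<in> measurable ?R motion_borel"
      by (rule measurable_restrict_space2)
         (auto simp: sR intro!: measurable_restrict_space1)
  qed (auto simp: sR space_restrict_space)
  have 2: "(\<lambda>x. x) \<in> measurable path_space ?R"
  proof (rule measurable_restrict_space2)
    show "(\<lambda>x. x) \<in> measurable path_space ?B"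
    proof (rule measurable_PiM_single')
      fix i :: int
      have "(\<lambda>x. x i) \<in> measurable path_space motion_borel" by measurable
      thus "(\<lambda>x. x i) \<in> measurable path_space borel"
        by (simp add: measurable_restrict_space2_iff)
    qed auto
  qed (auto simp: space_path_space)
  have "sets path_space = sets ?R"
  proof (intro antisym subsetI)
    fix A assume A: "A \<in> sets path_space"
    have "A \<subseteq> ?C" using sets.sets_into_space[OF A] by (simp add: space_path_space)
    thus "A \<in> sets ?R" using measurable_sets[OF 1 A] by (simp add: sR Int_absorb2)
  next
    fix A assume A: "A \<in> sets ?R"
    have "A \<subseteq> ?C" using sets.sets_into_space[OF A] by (simp add: sR)
    thus "A \<in> sets path_space" using measurable_sets[OF 2 A] by (simp add: space_path_space Int_absorb2)
  qed
  also have "\<dots> = sets (restrict_space borel ?C)"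
    by (intro sets_restrict_space_cong sets_PiM_equal_borel)
  finally show ?thesis .
qed

lemma closed_paths: "closed (UNIV \<rightarrow>\<^sub>E carrier motion_group :: (int \<Rightarrow> complex\<times>complex) set)"
proof -
  have "closed (\<Inter>i::int. (\<lambda>u::int \<Rightarrow> complex\<times>complex. u i) -` carrier motion_group)"
    by (intro closed_INT ballI closed_vimage closed_motion_group continuous_on_product_coordinates)
  moreover have "(\<Inter>i::int. (\<lambda>u::int \<Rightarrow> complex\<times>complex. u i) -` carrier motion_group) = (UNIV \<rightarrow>\<^sub>E carrier motion_group)"
    by (auto simp: PiE_def)
  ultimately show ?thesis by simp
qed

lemma standard_probability_space_path:
  assumes "prob_space M" "sets M = sets path_space"
  shows "standard_probability_space M"
proof -
  let ?C = "UNIV \<rightarrow>\<^sub>E carrier motion_group :: (int \<Rightarrow> complex\<times>complex) set"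
  have "space M = ?C" using sets_eq_imp_space_eq[OF assms(2)] by (simp add: space_path_space)
  moreover have "completely_metrizable_space (top_of_set ?C)"
    using closed_paths completely_metrizable_space_closedin[OF completely_metrizable_space_euclidean] by auto
  moreover have "second_countable (top_of_set ?C)"
  proof (rule second_countable_subtopology)
    obtain B :: "(int \<Rightarrow> complex\<times>complex) set set" where B: "countable B" "topological_basis B"
      using ex_countable_basis by blast
    show "second_countable (euclidean :: (int \<Rightarrow> complex\<times>complex) topology)"
      unfolding second_countable_def
    proof (intro exI[of _ B] conjI ballI allI impI)
      fix V assume "V \<in> B" thus "openin euclidean V" using topological_basis_open[OF B(2)] by simp
    next
      fix U x assume "openin (euclidean :: (int \<Rightarrow> complex\<times>complex) topology) U \<and> x \<in> U"
      thus "\<exists>V\<in>B. x \<in> V \<and> V \<subseteq> U" using topological_basisE[OF B(2), of U x] by (metis open_openin)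
    qed (rule B(1))
  qed
  moreover have "sets M = sigma_sets ?C {U. openin (top_of_set ?C) U}"
  proof -
    have "{U. openin (top_of_set ?C) U} = (\<inter>) ?C ` {S. open S}"
      by (auto simp: openin_open)
    moreover have "?C \<in> sigma_sets UNIV {S. open S}"
      using borel_closed[OF closed_paths] by (simp only: sets_borel)
    ultimately show ?thesis
      using sigma_sets_Int[of ?C UNIV "{S. open S}"]
      by (simp add: assms(2) sets_path_space sets_restrict_space sets_borel)
  qed
  ultimately show ?thesis
    using assms(1) unfolding standard_probability_space_def
    by (intro conjI exI[of _ "top_of_set ?C"]) simp_all
qed

lemma realizes_path_shift:
  assumes "motion_process M Z" "stationary_process M Z"
  shows "realizes (path_law M Z) path_shift (\<lambda>u. u 0) M Z"
proof -
  have Zm: "(\<lambda>\<omega> k. Z k \<omega>) \<in> measurable M path_space"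
  proof (rule measurable_PiM_single')
    have m: "Z i \<in> measurable M motion_borel" for i using assms(1) by (simp add: motion_process_def)
    show "Z i \<in> measurable M motion_borel" for i by (rule m)
    show "(\<lambda>\<omega> k. Z k \<omega>) \<in> space M \<rightarrow> (UNIV \<rightarrow>\<^sub>E space motion_borel)"
      using measurable_space[OF m] by (auto simp: PiE_def)
  qed
  let ?N = "path_law M Z"
  have sN [simp]: "sets ?N = sets path_space" "space ?N = UNIV \<rightarrow>\<^sub>E carrier motion_group"
    by (simp_all add: path_law_def space_path_space)
  have p: "prob_space ?N" unfolding path_law_def
    using assms(1) Zm by (auto simp: motion_process_def intro: prob_space.prob_space_distr)
  have bij: "bij_betw path_shift (space ?N) (space ?N)"
    by (rule bij_betw_byWitness[where f' = path_unshift])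
       (auto simp: path_shift_def path_unshift_def)
  have inv: "the_inv_into (space ?N) path_shift u = path_unshift u" if "u \<in> space ?N" for u
    by (rule the_inv_into_f_eq[OF bij_betw_imp_inj_on[OF bij]])
       (use that in \<open>auto simp: path_shift_def path_unshift_def\<close>)
  have shm: "path_shift \<in> measurable ?N ?N" using measurable_path_shift by (simp cong: measurable_cong_sets)
  have invm: "the_inv_into (space ?N) path_shift \<in> measurable ?N ?N"
    using measurable_path_unshift by (subst measurable_cong[OF inv]) (simp_all cong: measurable_cong_sets)
  have "distr ?N ?N path_shift = distr ?N path_space path_shift"
    by (rule distr_cong) auto
  also have "\<dots> = path_law M (\<lambda>k. Z (k + 1))"
    unfolding path_law_def by (subst distr_distr[OF measurable_path_shift Zm]) (simp add: o_def path_shift_def)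
  also have "\<dots> = ?N" using assms(2) by (simp add: stationary_process_def)
  finally have mp: "distr ?N ?N path_shift = ?N" .
  have p1: "(path_shift ^^ n) u = (\<lambda>k. u (k + int n))" for n and u :: "int \<Rightarrow> complex \<times> complex"
    by (induction n) (auto simp: path_shift_def algebra_simps)
  have p2: "(the_inv_into (space ?N) path_shift ^^ n) u = (\<lambda>k. u (k - int n))"
    if u: "u \<in> space ?N" for n u
  proof (induction n)
    case (Suc n)
    have "(\<lambda>k. u (k - int n)) \<in> space ?N" using u by auto
    thus ?case by (simp only: funpow.simps o_def Suc inv) (simp add: path_unshift_def algebra_simps)
  qed simp
  have it: "int_iter ?N path_shift k u 0 = u k" if "u \<in> space ?N" for k u
    using p1[of "nat k" u] p2[OF that, of "nat (-k)"] by (simp add: int_iter_def)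
  have "path_law ?N (\<lambda>k x. int_iter ?N path_shift k x 0) = distr ?N path_space (\<lambda>u. u)"
    unfolding path_law_def[of ?N] by (rule distr_cong) (simp_all add: it)
  also have "\<dots> = ?N" by (rule distr_id2) simp
  finally have law: "path_law ?N (\<lambda>k x. int_iter ?N path_shift k x 0) = ?N" .
  have "(\<lambda>u. u 0) \<in> measurable ?N motion_borel"
    by (simp cong: measurable_cong_sets)
  thus ?thesis
    using standard_probability_space_path[OF p] bij shm invm mp law by (simp add: realizes_def invertible_mpt_def)
qed

end

theory Submission
  imports Defs
begin

text \<open>If the walk is not recurrent, some set \<open>B\<close> of positive measure and some neighbourhood of the
  identity admit no returns. Along every orbit the points \<open>S\<^sub>n\<close> with \<open>T\<^sup>n x \<in> B\<close> are then uniformly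
  separated, so at most \<open>O(R\<^sup>2)\<close> of them project into the disc of radius \<open>R\<close>. Ergodicity of the
  process spreads the times spent in \<open>B\<close> evenly: off a set of measure \<open>\<epsilon>\<close>, every stretch of fixed length
  \<open>L(\<epsilon>)\<close> meets \<open>B\<close> with a frequency bounded below independently of \<open>\<epsilon>\<close>. Hence
  \<open>\<Sum>\<^bsub>n \<in> I\<^esub> (P(|\<pi>(S\<^sub>n)| \<le> R) - \<epsilon>) \<le> C R\<^sup>2\<close> for all finite \<open>I\<close> and all large \<open>R\<close>, with \<open>C\<close> independent of \<open>\<epsilon>\<close>. On the
  other hand each of the blocks \<open>4\<^sup>j R\<^sup>2 < n \<le> 4\<^bsup>j+1\<^esup> R\<^sup>2\<close>, \<open>j < J\<close>, contributes at least a fixed multiple of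
  \<open>R\<^sup>2\<close> to the left-hand side by the hypothesis with \<open>\<eta> = 2\<^bsup>-(j+1)\<^esup>\<close>, which is a contradiction for large \<open>J\<close>.\<close>

section \<open>A maximal ergodic theorem\<close>

lemma measurable_funpow:
  assumes "T \<in> measurable M M"
  shows "T ^^ n \<in> measurable M M"
proof (induction n)
  case (Suc n)
  show ?case unfolding funpow.simps using Suc assms by (rule measurable_comp)
qed (simp add: id_def)

text \<open>Serves both for the transformation of a realization and for the shift under the law of
  the process. Ergodicity is left to single lemmas, because it is given for the shift only.\<close>

locale measure_preserving = prob_space M for M :: "'a measure" +
  fixes T :: "'a \<Rightarrow> 'a"
  assumes measurable_T [measurable]: "T \<in> measurable M M" and distr_T: "distr M M T = M"
begin

lemmas measurable_iterate [measurable] = measurable_funpow[OF measurable_T]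

lemma funpow_in_space: "x \<in> space M \<Longrightarrow> (T ^^ n) x \<in> space M"
  using measurable_space[OF measurable_iterate] .

lemma distr_funpow: "distr M M (T ^^ n) = M"
proof (induction n)
  case 0
  show ?case by (simp add: id_def distr_id)
next
  case (Suc n)
  have "distr M M (T ^^ Suc n) = distr (distr M M (T ^^ n)) M T"
    unfolding funpow.simps by (rule distr_distr[symmetric]) measurable
  also have "\<dots> = M" by (simp only: Suc distr_T)
  finally show ?case .
qed

lemma nn_integral_funpow:
  assumes [measurable]: "\<phi> \<in> borel_measurable M"
  shows "(\<integral>\<^sup>+x. \<phi> ((T ^^ n) x) \<partial>M) = (\<integral>\<^sup>+x. \<phi> x \<partial>M)"
  by (subst (2) distr_funpow[of n, symmetric]) (simp add: nn_integral_distr)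

lemma prob_funpow:
  assumes [measurable]: "A \<in> sets M"
  shows "prob {x \<in> space M. (T ^^ n) x \<in> A} = prob A"
proof -
  have "prob A = measure (distr M M (T ^^ n)) A" by (simp add: distr_funpow)
  also have "\<dots> = prob {x \<in> space M. (T ^^ n) x \<in> A}"
    by (subst measure_distr) (auto intro!: arg_cong[where f=prob])
  finally show ?thesis by simp
qed

text \<open>This is the maximum of the Birkhoff sums of length 0 to \<open>n\<close>, the empty sum
  being 0. The recursive form yields Garsia's inequality without handling the maximum of a finite
  set.\<close>

primrec max_birkhoff_sum :: "('a \<Rightarrow> real) \<Rightarrow> nat \<Rightarrow> 'a \<Rightarrow> real" where
  "max_birkhoff_sum g 0 x = 0"
| "max_birkhoff_sum g (Suc n) x = max 0 (g x + max_birkhoff_sum g n (T x))"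

lemma max_birkhoff_sum_nonneg: "0 \<le> max_birkhoff_sum g n x"
  by (cases n) auto

lemma max_birkhoff_sum_mono: "max_birkhoff_sum g n x \<le> max_birkhoff_sum g (Suc n) x"
proof (induction n arbitrary: x)
  case (Suc n)
  from Suc[of "T x"] show ?case by auto
qed auto

lemma incseq_max_birkhoff_sum: "incseq (\<lambda>n. max_birkhoff_sum g n x)"
  by (rule incseq_SucI) (rule max_birkhoff_sum_mono)

lemma birkhoff_sum_le_max: "(\<Sum>k<n. g ((T ^^ k) x)) \<le> max_birkhoff_sum g n x"
proof (induction n arbitrary: x)
  case (Suc n)
  have "(\<Sum>k<Suc n. g ((T ^^ k) x)) = g x + (\<Sum>k<n. g ((T ^^ k) (T x)))"
    by (subst sum.lessThan_Suc_shift) (simp add: funpow_swap1)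
  with Suc[of "T x"] show ?case by simp
qed simp

lemma integrable_comp_T: "integrable M g \<Longrightarrow> integrable M (\<lambda>x. g (T x))" for g :: "'a \<Rightarrow> real"
  using integrable_distr[OF measurable_T, of g] by (simp add: distr_T)

lemma integral_comp_T: "(\<integral>x. g (T x) \<partial>M) = (\<integral>x. g x \<partial>M)"
  if [measurable]: "g \<in> borel_measurable M" for g :: "'a \<Rightarrow> real"
  by (subst (2) distr_T[symmetric]) (simp add: integral_distr)

lemma integrable_max_birkhoff_sum:
  assumes "integrable M g"
  shows "integrable M (max_birkhoff_sum g n)"
proof (induction n)
  case 0
  have "max_birkhoff_sum g 0 = (\<lambda>x. 0)" by auto
  then show ?case by simp
next
  case (Suc n)
  have "max_birkhoff_sum g (Suc n) = (\<lambda>x. max 0 (g x + max_birkhoff_sum g n (T x)))" by auto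
  then show ?case
    using assms integrable_comp_T[OF Suc] by simp
qed

text \<open>Garsia's argument: where the running maximum \<open>m\<close> is positive, \<open>g \<ge> m - m \<circ> T\<close>.\<close>

lemma integral_max_birkhoff_sum_pos:
  assumes g: "integrable M g"
  shows "0 \<le> (\<integral>x. g x * of_bool (0 < max_birkhoff_sum g n x) \<partial>M)"
proof -
  let ?m = "max_birkhoff_sum g n"
  note m = integrable_max_birkhoff_sum[OF g, of n]
  have [measurable]: "g \<in> borel_measurable M" "?m \<in> borel_measurable M"
    using g m by auto
  have "0 = (\<integral>x. ?m x - ?m (T x) \<partial>M)"
    using m integrable_comp_T[OF m] integral_comp_T[of ?m] by simp
  also have "\<dots> \<le> (\<integral>x. g x * of_bool (0 < ?m x) \<partial>M)"
  proof (rule integral_mono)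
    show "integrable M (\<lambda>x. g x * of_bool (0 < ?m x))"
      by (rule Bochner_Integration.integrable_bound[OF g]) auto
    \<comment> \<open>If \<open>?m x\<close> is positive, it is at most the next maximum, which then
      equals \<open>g x + ?m (T x)\<close>. Otherwise \<open>?m x = 0\<close> and the left side is
      \<open>- ?m (T x)\<close>, which is nonpositive.\<close>
    show "?m x - ?m (T x) \<le> g x * of_bool (0 < ?m x)" for x
      using max_birkhoff_sum_mono[of g n x] max_birkhoff_sum_nonneg[of g n x]
        max_birkhoff_sum_nonneg[of g n "T x"]
      by (cases "0 < ?m x") (auto simp: max_def split: if_splits)
  qed (use m integrable_comp_T[OF m] in simp)
  finally show ?thesis .
qed

text \<open>By hypothesis the indicators of positive maxima increase to 1 almost everywhere, so
  dominated convergence carries Garsia's inequality over to the whole integral.\<close>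

lemma integral_nonneg_of_birkhoff_sums:
  fixes g :: "'a \<Rightarrow> real"
  assumes g: "integrable M g" and pos: "AE x in M. \<exists>n. 0 < (\<Sum>k<n. g ((T ^^ k) x))"
  shows "0 \<le> (\<integral>x. g x \<partial>M)"
proof -
  have [measurable]: "g \<in> borel_measurable M" "max_birkhoff_sum g n \<in> borel_measurable M" for n
    using g integrable_max_birkhoff_sum[OF g, of n] by auto
  have "(\<lambda>n. \<integral>x. g x * of_bool (0 < max_birkhoff_sum g n x) \<partial>M) \<longlonglongrightarrow> (\<integral>x. g x \<partial>M)"
  proof (rule integral_dominated_convergence[where w = "\<lambda>x. \<bar>g x\<bar>"])
    show "AE x in M. (\<lambda>n. g x * of_bool (0 < max_birkhoff_sum g n x)) \<longlonglongrightarrow> g x"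
      using pos
    proof eventually_elim
      case (elim x)
      then obtain n where "0 < (\<Sum>k<n. g ((T ^^ k) x))" by blast
      then have "0 < max_birkhoff_sum g n x"
        using birkhoff_sum_le_max[of g x n] by (rule less_le_trans)
      then have "0 < max_birkhoff_sum g k x" if "k \<ge> n" for k
        using incseqD[OF incseq_max_birkhoff_sum that, of g x] by linarith
      then have "\<forall>\<^sub>F k in sequentially. g x * of_bool (0 < max_birkhoff_sum g k x) = g x"
        by (auto simp: eventually_sequentially)
      then show ?case by (simp add: tendsto_eventually)
    qed
  qed (use g in auto)
  then show ?thesis
    by (rule LIMSEQ_le_const) (use integral_max_birkhoff_sum_pos[OF g] in auto)
qed

text \<open>A one-sided substitute for the pointwise ergodic theorem. If the Birkhoff sums of
  \<open>b - h\<close> were unbounded above almost everywhere, the maximal inequality would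
  contradict \<open>b\<close> being below the mean of \<open>h\<close>. By ergodicity they are
  therefore bounded above almost everywhere, and by a single constant off a small set; for large
  \<open>L\<close> the slack \<open>(b - a) * L\<close> absorbs this constant.\<close>

lemma ergodic_averages_bounded_below:
  fixes h :: "'a \<Rightarrow> real"
  assumes ergodic: "\<And>A. A \<in> sets M \<Longrightarrow> T -` A \<inter> space M = A \<Longrightarrow> prob A \<in> {0, 1}"
    and h: "integrable M h"
    and a: "a < (\<integral>x. h x \<partial>M)" and \<epsilon>: "0 < \<epsilon>"
  shows "\<exists>L>0. 1 - \<epsilon> < prob {x \<in> space M. a * real L \<le> (\<Sum>i<L. h ((T ^^ i) x))}"
proof -
  define b where "b = (a + (\<integral>x. h x \<partial>M)) / 2"
  have b: "a < b" "b < (\<integral>x. h x \<partial>M)" using a by (auto simp: b_def)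
  define g where "g x = b - h x" for x
  define S where "S n x = (\<Sum>k<n. g ((T ^^ k) x))" for n x
  have g: "integrable M g" using h by (simp add: g_def[abs_def])
  then have [measurable]: "g \<in> borel_measurable M" by auto
  have [measurable]: "h \<in> borel_measurable M" using h by auto
  have [measurable]: "S n \<in> borel_measurable M" for n
    unfolding S_def[abs_def] by measurable
  have S_Suc: "S (Suc n) x = g x + S n (T x)" for n x
    unfolding S_def by (subst sum.lessThan_Suc_shift) (simp add: funpow_swap1)
  \<comment> \<open>The set where the sums are unbounded above. Bounds run over the naturals, so
    that measurability is a matter of countable operations.\<close>
  define D where "D = {x \<in> space M. \<forall>C::nat. \<exists>n. real C < S n x}"
  have D [measurable]: "D \<in> sets M" unfolding D_def by measurable
  have "T x \<in> D \<longleftrightarrow> x \<in> D" if x: "x \<in> space M" for x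
  proof -
    have Tx: "T x \<in> space M" using measurable_space[OF measurable_T x] .
    \<comment> \<open>Going from \<open>x\<close> to \<open>T x\<close> shifts the index by one and
      changes the sums by \<open>g x\<close>. Raising the bound by the rounded
      \<open>\<bar>g x\<bar>\<close> compensates for this.\<close>
    have "(\<forall>C::nat. \<exists>n. real C < S n (T x)) \<longleftrightarrow> (\<forall>C::nat. \<exists>n. real C < S n x)"
    proof (intro iffI allI)
      fix C :: nat
      assume "\<forall>C::nat. \<exists>n. real C < S n (T x)"
      then obtain n where "real (C + nat \<lceil>\<bar>g x\<bar>\<rceil>) < S n (T x)" by blast
      then have "real C < S (Suc n) x" unfolding S_Suc by (simp, linarith)
      then show "\<exists>n. real C < S n x" by blast
    next
      fix C :: nat
      assume "\<forall>C::nat. \<exists>n. real C < S n x"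
      then obtain n where n: "real (C + nat \<lceil>\<bar>g x\<bar>\<rceil>) < S n x" by blast
      then have "0 < S n x" using of_nat_0_le_iff le_less_trans by blast
      then have "n \<noteq> 0" by (auto simp: S_def intro!: gr0I)
      then obtain m where m: "n = Suc m" using not0_implies_Suc by auto
      have "real C < S m (T x)" using n[unfolded m S_Suc] by (simp, linarith)
      then show "\<exists>n. real C < S n (T x)" by blast
    qed
    then show ?thesis using x Tx by (simp add: D_def)
  qed
  then have "T -` D \<inter> space M = D" by (auto simp: D_def)
  then have "prob D \<in> {0, 1}" by (rule ergodic[OF D])
  moreover have "prob D \<noteq> 1"
  proof
    assume "prob D = 1"
    then have "AE x in M. x \<in> D" by (simp add: prob_eq_1)
    then have "AE x in M. \<exists>n. 0 < (\<Sum>k<n. g ((T ^^ k) x))"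
    proof eventually_elim
      case (elim x)
      then obtain n where "real 0 < S n x" unfolding D_def by blast
      then show ?case by (auto simp: S_def)
    qed
    then have "0 \<le> (\<integral>x. g x \<partial>M)" by (rule integral_nonneg_of_birkhoff_sums[OF g])
    then show False using b h by (simp add: g_def[abs_def] prob_space)
  qed
  ultimately have D0: "prob D = 0" by simp
  define G where "G C = {x \<in> space M. \<forall>n. S n x \<le> real C}" for C :: nat
  have [measurable]: "G C \<in> sets M" for C unfolding G_def by measurable
  have "(\<lambda>C. prob (G C)) \<longlonglongrightarrow> prob (\<Union>C. G C)"
  proof (rule finite_Lim_measure_incseq)
    show "incseq G"
      by (auto simp: incseq_def G_def) (meson of_nat_mono order_trans)
  qed auto
  moreover have "(\<Union>C. G C) = space M - D" by (auto simp: G_def D_def simp flip: not_le)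
  ultimately have "(\<lambda>C. prob (G C)) \<longlonglongrightarrow> 1" using prob_compl[OF D] D0 by simp
  then have "\<forall>\<^sub>F C in sequentially. 1 - \<epsilon> < prob (G C)"
    by (rule order_tendstoD) (use \<epsilon> in simp)
  then obtain C where C: "1 - \<epsilon> < prob (G C)" by (auto simp: eventually_sequentially)
  obtain L :: nat where L: "real C / (b - a) < real L" using reals_Archimedean2 by blast
  then have LC: "real C \<le> (b - a) * real L" using b by (simp add: field_simps)
  have "0 < L" using L b by (intro gr0I) (auto simp: field_simps)
  moreover have "G C \<subseteq> {x \<in> space M. a * real L \<le> (\<Sum>i<L. h ((T ^^ i) x))}"
  proof
    fix x assume x: "x \<in> G C"
    then have "S L x \<le> real C" by (simp add: G_def)
    moreover have "S L x = b * real L - (\<Sum>i<L. h ((T ^^ i) x))"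
      by (simp add: S_def g_def sum_subtractf)
    ultimately show "x \<in> {x \<in> space M. a * real L \<le> (\<Sum>i<L. h ((T ^^ i) x))}"
      using x LC by (simp add: G_def algebra_simps)
  qed
  then have "prob (G C) \<le> prob {x \<in> space M. a * real L \<le> (\<Sum>i<L. h ((T ^^ i) x))}"
    by (intro finite_measure_mono) measurable
  ultimately show ?thesis using C by (intro exI[of _ L]) auto
qed

end

section \<open>Separated visits of the walk\<close>

lemma card_floor_range:
  assumes "finite F" "\<And>p. p \<in> F \<Longrightarrow> \<bar>t p\<bar> \<le> R" "0 < s" "0 \<le> R"
  shows "real (card ((\<lambda>p. \<lfloor>t p / s :: real\<rfloor>) ` F)) \<le> 2 * R / s + 2"
proof -
  have "(\<lambda>p. \<lfloor>t p / s\<rfloor>) ` F \<subseteq> {\<lfloor>- (R / s)\<rfloor>..\<lfloor>R / s\<rfloor>}"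
  proof (rule image_subsetI)
    fix p assume "p \<in> F"
    then have "- R \<le> t p" "t p \<le> R" using assms(2)[of p] by (auto simp: abs_le_iff)
    then have "- (R / s) \<le> t p / s" "t p / s \<le> R / s"
      using assms(3) divide_right_mono[of "-R" "t p" s] divide_right_mono[of "t p" R s] by auto
    then show "\<lfloor>t p / s\<rfloor> \<in> {\<lfloor>- (R / s)\<rfloor>..\<lfloor>R / s\<rfloor>}"
      using floor_mono by auto
  qed
  then have "card ((\<lambda>p. \<lfloor>t p / s\<rfloor>) ` F) \<le> card {\<lfloor>- (R / s)\<rfloor>..\<lfloor>R / s\<rfloor>}"
    by (rule card_mono[rotated]) simp
  also have "real \<dots> \<le> 2 * (R / s) + 2"
  proof -
    have "0 \<le> R / s" using assms by simp
    then show ?thesis by simp linarith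
  qed
  finally show ?thesis by simp
qed

lemma abs_diff_less_of_floor_eq:
  assumes "\<lfloor>x / s :: real\<rfloor> = \<lfloor>y / s\<rfloor>" "0 < s"
  shows "\<bar>x - y\<bar> < s"
proof -
  have "\<bar>x / s - y / s\<bar> < 1" using assms(1) by linarith
  then have "\<bar>x - y\<bar> / s < 1" using assms(2) by (simp flip: diff_divide_distrib)
  then show ?thesis using assms(2) by simp
qed

text \<open>Pigeonhole over a grid of mesh \<open>\<delta> / 2\<close> in the four real coordinates:
  two points in one cell have both components closer than \<open>\<delta>\<close>. The two
  coordinates of the second component take boundedly many values, so only the first component
  contributes growth in \<open>R\<close>, which is quadratic.\<close>

lemma card_separated_le:
  fixes F :: "(complex \<times> complex) set"
  assumes "finite F" and \<delta>: "0 < \<delta>" and R: "1 \<le> R"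
    and bd: "\<And>p. p \<in> F \<Longrightarrow> cmod (fst p) \<le> R \<and> cmod (snd p) \<le> 1"
    and sep: "\<And>p q. p \<in> F \<Longrightarrow> q \<in> F \<Longrightarrow> p \<noteq> q \<Longrightarrow>
            \<delta> \<le> cmod (fst p - fst q) \<or> \<delta> \<le> cmod (snd p - snd q)"
  shows "real (card F) \<le> (4 / \<delta> + 2) ^ 4 * R\<^sup>2"
proof -
  define s where "s = \<delta> / 2"
  have s: "0 < s" using \<delta> by (simp add: s_def)
  define c where "c t p = \<lfloor>t p / s\<rfloor>" for t :: "complex \<times> complex \<Rightarrow> real" and p
  define t1 where "t1 p = Re (fst p)" for p :: "complex \<times> complex"
  define t2 where "t2 p = Im (fst p)" for p :: "complex \<times> complex"
  define t3 where "t3 p = Re (snd p)" for p :: "complex \<times> complex"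
  define t4 where "t4 p = Im (snd p)" for p :: "complex \<times> complex"
  note t_defs = t1_def t2_def t3_def t4_def
  have close: "cmod (x - y) < \<delta>"
    if "\<lfloor>Re x / s\<rfloor> = \<lfloor>Re y / s\<rfloor>" "\<lfloor>Im x / s\<rfloor> = \<lfloor>Im y / s\<rfloor>" for x y
    using cmod_le[of "x - y"] abs_diff_less_of_floor_eq[OF that(1) s]
      abs_diff_less_of_floor_eq[OF that(2) s]
    by (simp add: s_def)
  have "inj_on (\<lambda>p. (c t1 p, c t2 p, c t3 p, c t4 p)) F"
  proof (rule inj_onI, rule ccontr)
    fix p q assume "p \<in> F" "q \<in> F" "p \<noteq> q"
      and "(c t1 p, c t2 p, c t3 p, c t4 p) = (c t1 q, c t2 q, c t3 q, c t4 q)"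
    then show False
      using sep[of p q] close[of "fst p" "fst q"] close[of "snd p" "snd q"]
      by (auto simp: c_def t_defs)
  qed
  then have "card F = card ((\<lambda>p. (c t1 p, c t2 p, c t3 p, c t4 p)) ` F)"
    by (simp add: card_image)
  also have "\<dots> \<le> card ((c t1 ` F) \<times> (c t2 ` F) \<times> (c t3 ` F) \<times> (c t4 ` F))"
    using \<open>finite F\<close> by (intro card_mono) auto
  also have "\<dots> = card (c t1 ` F) * (card (c t2 ` F) * (card (c t3 ` F) * card (c t4 ` F)))"
    by (simp add: card_cartesian_product)
  finally have "real (card F)
      \<le> real (card (c t1 ` F) * (card (c t2 ` F) * (card (c t3 ` F) * card (c t4 ` F))))"
    by (rule of_nat_mono)
  also have "\<dots> = real (card (c t1 ` F)) * (real (card (c t2 ` F)) * (real (card (c t3 ` F)) * real (card (c t4 ` F))))"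
    by simp
  also have "\<dots> \<le> (2 * R / s + 2) * ((2 * R / s + 2) * ((2 * 1 / s + 2) * (2 * 1 / s + 2)))"
  proof -
    have "\<bar>t1 p\<bar> \<le> R \<and> \<bar>t2 p\<bar> \<le> R \<and> \<bar>t3 p\<bar> \<le> 1 \<and> \<bar>t4 p\<bar> \<le> 1" if "p \<in> F" for p
      using bd[OF that] abs_Re_le_cmod[of "fst p"] abs_Im_le_cmod[of "fst p"]
        abs_Re_le_cmod[of "snd p"] abs_Im_le_cmod[of "snd p"]
      unfolding t_defs by linarith
    then have "real (card (c t1 ` F)) \<le> 2 * R / s + 2" "real (card (c t2 ` F)) \<le> 2 * R / s + 2"
      "real (card (c t3 ` F)) \<le> 2 * 1 / s + 2" "real (card (c t4 ` F)) \<le> 2 * 1 / s + 2"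
      unfolding c_def using \<open>finite F\<close> s R
        card_floor_range[of F t1 R s] card_floor_range[of F t2 R s]
        card_floor_range[of F t3 1 s] card_floor_range[of F t4 1 s] by simp_all
    then show ?thesis using s R
      by (intro mult_mono) auto
  qed
  also have "\<dots> \<le> (R * (2 / s + 2)) * ((R * (2 / s + 2)) * ((2 / s + 2) * (2 / s + 2)))"
  proof -
    have "2 * R / s + 2 \<le> R * (2 / s + 2)" using R by (simp add: algebra_simps)
    then show ?thesis using s R by (intro mult_mono) auto
  qed
  also have "\<dots> = (4 / \<delta> + 2) ^ 4 * R\<^sup>2"
  proof -
    have "2 / s = 4 / \<delta>" by (simp add: s_def)
    then show ?thesis by (simp only: power2_eq_square power4_eq_xxxx mult_ac)
  qed
  finally show ?thesis .
qed

section \<open>Algebra of the walk\<close>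

lemma mult_motion_group [simp]:
  "p \<otimes>\<^bsub>motion_group\<^esub> q = (fst p + snd p * fst q, snd p * snd q)"
  by (simp add: motion_group_def split_beta)

lemma one_motion_group [simp]: "\<one>\<^bsub>motion_group\<^esub> = (0, 1)"
  by (simp add: motion_group_def)

text \<open>The cocycle identity: the walk restarted at time \<open>n\<close> multiplies from the
  left.\<close>

lemma walk_add:
  "walk z (n + i) = walk (\<lambda>k. z (n + k)) i \<otimes>\<^bsub>motion_group\<^esub> walk z n"
  by (induction i) (auto simp: algebra_simps)

lemma norm_snd_walk:
  assumes "\<And>k. z k \<in> carrier motion_group"
  shows "cmod (snd (walk z n)) = 1"
proof (induction n)
  case (Suc n)
  have "cmod (snd (z n)) = 1" using assms[of n] by (auto simp: motion_group_def)
  with Suc show ?case by (simp add: norm_mult)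
qed simp

text \<open>The later walk acts on the earlier displacement by a rotation, which preserves its
  modulus, followed by a translation. This makes the displacement subadditive along orbits.\<close>

lemma cmod_fst_walk_add_le:
  assumes "\<And>k. z k \<in> carrier motion_group"
  shows "cmod (fst (walk z (n + i)))
    \<le> cmod (fst (walk z n)) + cmod (fst (walk (\<lambda>k. z (n + k)) i))"
  using norm_triangle_ineq[of "fst (walk (\<lambda>k. z (n + k)) i)"
      "snd (walk (\<lambda>k. z (n + k)) i) * fst (walk z n)"]
    norm_snd_walk[of "\<lambda>k. z (n + k)" i] assms
  by (simp add: walk_add norm_mult)

lemma measurable_walk:
  assumes [measurable]: "\<And>k. z k \<in> borel_measurable M"
  shows "(\<lambda>x. walk (\<lambda>k. z k x) n) \<in> borel_measurable M"
proof (induction n)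
  case (Suc n)
  note [measurable] = Suc
  have "z k \<in> measurable M (borel \<Otimes>\<^sub>M borel)" for k
    using assms by (simp add: borel_prod)
  moreover have "(\<lambda>x. walk (\<lambda>k. z k x) n) \<in> measurable M (borel \<Otimes>\<^sub>M borel)"
    using Suc by (simp add: borel_prod)
  ultimately have [measurable]: "(\<lambda>x. fst (z k x)) \<in> borel_measurable M"
    "(\<lambda>x. snd (z k x)) \<in> borel_measurable M"
    "(\<lambda>x. fst (walk (\<lambda>k. z k x) n)) \<in> borel_measurable M"
    "(\<lambda>x. snd (walk (\<lambda>k. z k x) n)) \<in> borel_measurable M" for k
    by (auto intro: measurable_fst' measurable_snd')
  show ?case by simp
qed simp

text \<open>In the coordinates \<open>(z / w, w)\<close> right translations become isometries, so visits to \<open>B\<close> at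
  which the walk does not return to a neighbourhood of the identity are uniformly separated.\<close>

lemma card_nonreturning_le:
  assumes z: "\<And>k. z k \<in> carrier motion_group"
    and "finite I" "0 < \<delta>" "1 \<le> R"
    and bd: "\<And>n. n \<in> I \<Longrightarrow> cmod (fst (walk z n)) \<le> R"
    and sep: "\<And>m n. m \<in> I \<Longrightarrow> n \<in> I \<Longrightarrow> m < n \<Longrightarrow>
      \<delta> \<le> cmod (fst (walk (\<lambda>k. z (m + k)) (n - m))) \<or>
      \<delta> \<le> cmod (snd (walk (\<lambda>k. z (m + k)) (n - m)) - 1)"
  shows "real (card I) \<le> (4 / \<delta> + 2) ^ 4 * R\<^sup>2"
proof -
  define e where "e n = (fst (walk z n) / snd (walk z n), snd (walk z n))" for n
  have w: "cmod (snd (walk z n)) = 1" for n using norm_snd_walk[OF z] .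
  \<comment> \<open>In modulus, both coordinate differences depend only on the increment
    \<open>q\<close> from time \<open>m\<close> to time \<open>n\<close>: they equal
    \<open>cmod (fst q)\<close> and \<open>cmod (snd q - 1)\<close>.\<close>
  have e: "\<delta> \<le> cmod (fst (e n) - fst (e m)) \<or> \<delta> \<le> cmod (snd (e n) - snd (e m))"
    if "m \<in> I" "n \<in> I" "m < n" for m n
  proof -
    define q where "q = walk (\<lambda>k. z (m + k)) (n - m)"
    have q: "cmod (snd q) = 1" unfolding q_def by (rule norm_snd_walk) (rule z)
    have n: "walk z n = (fst q + snd q * fst (walk z m), snd q * snd (walk z m))"
      using walk_add[of z m "n - m"] that(3) by (simp add: q_def)
    have "snd q \<noteq> 0" "snd (walk z m) \<noteq> 0" using q w[of m] by auto
    then have "fst (e n) - fst (e m) = fst q / (snd q * snd (walk z m))"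
      by (simp add: e_def n field_simps)
    then have 1: "cmod (fst (e n) - fst (e m)) = cmod (fst q)"
      by (simp add: norm_divide norm_mult q w)
    have "snd (e n) - snd (e m) = (snd q - 1) * snd (walk z m)"
      by (simp add: e_def n algebra_simps)
    then have 2: "cmod (snd (e n) - snd (e m)) = cmod (snd q - 1)"
      by (simp add: norm_mult w)
    show ?thesis using sep[OF that] unfolding 1 2 q_def .
  qed
  have e': "\<delta> \<le> cmod (fst (e n) - fst (e m)) \<or> \<delta> \<le> cmod (snd (e n) - snd (e m))"
    if "m \<in> I" "n \<in> I" "m \<noteq> n" for m n
    using e[of m n] e[of n m] that by (metis linorder_neqE_nat norm_minus_commute)
  have "inj_on e I"
    using e' \<open>0 < \<delta>\<close> by (force intro!: inj_onI)
  then have "real (card I) = real (card (e ` I))" by (simp add: card_image)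
  also have "\<dots> \<le> (4 / \<delta> + 2) ^ 4 * R\<^sup>2"
  proof (rule card_separated_le)
    fix p assume "p \<in> e ` I"
    then show "cmod (fst p) \<le> R \<and> cmod (snd p) \<le> 1"
      using bd by (auto simp: e_def norm_divide w)
  next
    fix p q assume "p \<in> e ` I" "q \<in> e ` I" "p \<noteq> q"
    then show "\<delta> \<le> cmod (fst p - fst q) \<or> \<delta> \<le> cmod (snd p - snd q)" using e' by auto
  qed (use assms in auto)
  finally show ?thesis .
qed

section \<open>Occupation times\<close>

context measure_preserving
begin

text \<open>If \<open>W n x \<le> R\<close> and the orbit is at a good point at time
  \<open>n\<close>, the next \<open>L\<close> times carry \<open>h\<close>-weight at least
  \<open>a * L\<close>, and by subadditivity \<open>W \<le> 2 * R\<close> holds throughout.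
  Summation over \<open>n\<close> bounds \<open>a * L\<close> times the number of such visits by
  \<open>L\<close> instances of \<open>bound\<close>. The factor \<open>L\<close> cancels, so the
  constant does not depend on \<open>\<epsilon>\<close>.\<close>

lemma occupation_bound:
  fixes W :: "nat \<Rightarrow> 'a \<Rightarrow> real" and h :: "'a \<Rightarrow> real"
  assumes ergodic: "\<And>A. A \<in> sets M \<Longrightarrow> T -` A \<inter> space M = A \<Longrightarrow> prob A \<in> {0, 1}"
    and W [measurable]: "\<And>n. W n \<in> borel_measurable M"
    and subadd: "\<And>n i x. x \<in> space M \<Longrightarrow> W (n + i) x \<le> W n x + W i ((T ^^ n) x)"
    and h [measurable]: "h \<in> borel_measurable M" and h01: "\<And>x. 0 \<le> h x \<and> h x \<le> 1"
    and pos: "0 < (\<integral>x. h x \<partial>M)"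
    and bound: "\<And>R I. 1 \<le> R \<Longrightarrow> finite I \<Longrightarrow>
      (\<Sum>n\<in>I. \<integral>x. h ((T ^^ n) x) * of_bool (W n x \<le> R) \<partial>M) \<le> C * R\<^sup>2"
  shows "\<exists>C'\<ge>0. \<forall>\<epsilon>>0. \<exists>K. \<forall>R\<ge>K. \<forall>I. finite I \<longrightarrow>
      (\<Sum>n\<in>I. prob {x \<in> space M. W n x \<le> R} - \<epsilon>) \<le> C' * R\<^sup>2"
proof -
  define a where "a = (\<integral>x. h x \<partial>M) / 2"
  have a: "0 < a" "a < (\<integral>x. h x \<partial>M)" using pos by (auto simp: a_def)
  have h_int: "integrable M h" by (rule integrable_const_bound[of _ 1]) (use h01 in auto)
  have C: "0 \<le> C" using bound[of 1 "{}"] by simp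
  show ?thesis
  proof (rule exI[of _ "4 * C / a"], intro conjI allI impI)
    fix \<epsilon> :: real assume \<epsilon>: "0 < \<epsilon>"
    obtain L where L: "0 < L"
      "1 - \<epsilon> / 2 < prob {x \<in> space M. a * real L \<le> (\<Sum>i<L. h ((T ^^ i) x))}"
      using ergodic_averages_bounded_below[OF ergodic h_int a(2), of "\<epsilon> / 2"] \<epsilon> by auto
    define G1 where "G1 = {x \<in> space M. a * real L \<le> (\<Sum>i<L. h ((T ^^ i) x))}"
    \<comment> \<open>\<open>L\<close> is already fixed, so finitely many displacements are to be
      bounded at once; a large \<open>K\<close> does this off a small set.\<close>
    define G2 where "G2 K = {x \<in> space M. \<forall>i<L. W i x \<le> real K}" for K :: nat
    have [measurable]: "G1 \<in> sets M" "G2 K \<in> sets M" for K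
      unfolding G1_def G2_def by measurable
    have "(\<lambda>K. prob (G2 K)) \<longlonglongrightarrow> prob (\<Union>K. G2 K)"
    proof (rule finite_Lim_measure_incseq)
      show "incseq G2"
        by (force simp: incseq_def G2_def)
    qed auto
    moreover have "(\<Union>K. G2 K) = space M"
    proof
      show "space M \<subseteq> (\<Union>K. G2 K)"
      proof
        fix x assume x: "x \<in> space M"
        define K where "K = nat \<lceil>\<Sum>i<L. \<bar>W i x\<bar>\<rceil>"
        have "W i x \<le> real K" if "i < L" for i
        proof -
          have "\<bar>W i x\<bar> \<le> (\<Sum>i<L. \<bar>W i x\<bar>)"
            by (rule member_le_sum) (use that in auto)
          then show ?thesis unfolding K_def by linarith
        qed
        then show "x \<in> (\<Union>K. G2 K)" using x by (auto simp: G2_def)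
      qed
    qed (auto simp: G2_def)
    ultimately have "(\<lambda>K. prob (G2 K)) \<longlonglongrightarrow> 1" by (simp add: prob_space)
    then have "\<forall>\<^sub>F K in sequentially. 1 - \<epsilon> / 2 < prob (G2 K)"
      by (rule order_tendstoD) (use \<epsilon> in simp)
    then obtain K where K: "1 - \<epsilon> / 2 < prob (G2 K)" by (auto simp: eventually_sequentially)
    \<comment> \<open>The bad points, where the average over \<open>L\<close> steps is too small or
      one of the first \<open>L\<close> displacements is too large. Each event has probability below
      \<open>\<epsilon> / 2\<close>.\<close>
    define B where "B = space M - (G1 \<inter> G2 K)"
    have [measurable]: "B \<in> sets M" unfolding B_def by measurable
    have "B = (space M - G1) \<union> (space M - G2 K)" by (auto simp: B_def)
    then have "prob B \<le> prob (space M - G1) + prob (space M - G2 K)"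
      by (simp add: measure_Un_le)
    then have B: "prob B \<le> \<epsilon>"
      using L(2) K by (simp add: prob_compl flip: G1_def)
    show "\<exists>K. \<forall>R\<ge>K. \<forall>I. finite I \<longrightarrow>
        (\<Sum>n\<in>I. prob {x \<in> space M. W n x \<le> R} - \<epsilon>) \<le> 4 * C / a * R\<^sup>2"
    \<comment> \<open>\<open>R \<ge> K\<close> controls the displacement during the next
      \<open>L\<close> steps, and \<open>R \<ge> 1\<close> makes \<open>bound\<close> applicable at
      radius \<open>2 * R\<close>.\<close>
    proof (intro exI[of _ "max 1 (real K)"] allI impI)
      fix R and I :: "nat set" assume R: "max 1 (real K) \<le> R" and I: "finite I"
      define F where "F n x = (of_bool (W n x \<le> R \<and> (T ^^ n) x \<notin> B) :: real)" for n x
      define H where "H n x = h ((T ^^ n) x) * of_bool (W n x \<le> 2 * R)" for n x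
      have [measurable]: "F n \<in> borel_measurable M" "H n \<in> borel_measurable M" for n
        unfolding F_def[abs_def] H_def[abs_def] by measurable
      have H0: "0 \<le> H n x" for n x using h01 by (simp add: H_def)
      have F_int: "integrable M (F n)" for n
        by (rule integrable_const_bound[of _ 1]) (auto simp: F_def)
      have H_int: "integrable M (H n)" for n
        by (rule integrable_const_bound[of _ 1]) (use h01 in \<open>auto simp: H_def\<close>)
      have FH: "a * real L * F n x \<le> (\<Sum>i<L. H (n + i) x)" if x: "x \<in> space M" for n x
      proof (cases "W n x \<le> R \<and> (T ^^ n) x \<notin> B")
        case True
        define y where "y = (T ^^ n) x"
        have y: "y \<in> G1" "y \<in> G2 K"
          using True funpow_in_space[OF x, of n] by (auto simp: B_def y_def)
        have "a * real L * F n x = a * real L" using True by (simp add: F_def)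
        also have "\<dots> \<le> (\<Sum>i<L. h ((T ^^ i) y))" using y(1) by (simp add: G1_def)
        also have "\<dots> = (\<Sum>i<L. H (n + i) x)"
        proof (rule sum.cong)
          fix i assume "i \<in> {..<L}"
          then have "W i y \<le> R" using y(2) R by (auto simp: G2_def)
          then have "W (n + i) x \<le> 2 * R"
            using subadd[OF x, of n i] True by (simp add: y_def)
          then show "h ((T ^^ i) y) = H (n + i) x"
            by (simp add: H_def y_def add.commute[of n] funpow_add)
        qed simp
        finally show ?thesis .
      next
        case False
        then show ?thesis using H0 by (auto simp: F_def intro: sum_nonneg)
      qed
      have pF: "prob {x \<in> space M. W n x \<le> R} - \<epsilon> \<le> (\<integral>x. F n x \<partial>M)" for n
      proof -
        have "prob {x \<in> space M. W n x \<le> R}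
            \<le> prob ({x \<in> space M. W n x \<le> R \<and> (T ^^ n) x \<notin> B} \<union> {x \<in> space M. (T ^^ n) x \<in> B})"
          by (intro finite_measure_mono) auto
        also have "\<dots> \<le> prob {x \<in> space M. W n x \<le> R \<and> (T ^^ n) x \<notin> B}
            + prob {x \<in> space M. (T ^^ n) x \<in> B}"
          by (intro measure_Un_le) measurable
        \<comment> \<open>Invariance of the measure makes the loss the same at every time
          \<open>n\<close>.\<close>
        also have "prob {x \<in> space M. (T ^^ n) x \<in> B} \<le> \<epsilon>"
          using B by (simp add: prob_funpow)
        also have "prob {x \<in> space M. W n x \<le> R \<and> (T ^^ n) x \<notin> B}
            = (\<integral>x. indicator {x \<in> space M. W n x \<le> R \<and> (T ^^ n) x \<notin> B} x \<partial>M)"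
          by simp
        also have "\<dots> = (\<integral>x. F n x \<partial>M)"
          by (rule Bochner_Integration.integral_cong) (auto simp: F_def)
        finally show ?thesis by simp
      qed
      have "a * real L * (\<Sum>n\<in>I. prob {x \<in> space M. W n x \<le> R} - \<epsilon>)
          \<le> a * real L * (\<Sum>n\<in>I. \<integral>x. F n x \<partial>M)"
        by (intro mult_left_mono sum_mono pF) (use a in auto)
      also have "\<dots> = (\<Sum>n\<in>I. \<integral>x. a * real L * F n x \<partial>M)"
        by (simp add: sum_distrib_left)
      also have "\<dots> \<le> (\<Sum>n\<in>I. \<integral>x. (\<Sum>i<L. H (n + i) x) \<partial>M)"
        by (intro sum_mono integral_mono FH) (auto simp: F_int H_int)
      also have "\<dots> = (\<Sum>i<L. \<Sum>n\<in>I. \<integral>x. H (n + i) x \<partial>M)"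
        by (subst sum.swap) (simp add: H_int)
      \<comment> \<open>For fixed \<open>i\<close> the times \<open>n + i\<close> form a translate
        of \<open>I\<close>; this is why \<open>bound\<close> is stated for arbitrary finite sets of
        times.\<close>
      also have "\<dots> = (\<Sum>i<L. \<Sum>m\<in>(\<lambda>n. n + i) ` I. \<integral>x. H m x \<partial>M)"
        by (simp add: sum.reindex)
      also have "\<dots> \<le> (\<Sum>i<L. C * (2 * R)\<^sup>2)"
        unfolding H_def by (intro sum_mono bound) (use R I in auto)
      also have "\<dots> = real L * (4 * C * R\<^sup>2)" by (simp add: power2_eq_square)
      finally have "real L * (a * (\<Sum>n\<in>I. prob {x \<in> space M. W n x \<le> R} - \<epsilon>))
          \<le> real L * (4 * C * R\<^sup>2)"
        by (simp add: algebra_simps)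
      then have "a * (\<Sum>n\<in>I. prob {x \<in> space M. W n x \<le> R} - \<epsilon>) \<le> 4 * C * R\<^sup>2"
        using L(1) by simp
      then show "(\<Sum>n\<in>I. prob {x \<in> space M. W n x \<le> R} - \<epsilon>) \<le> 4 * C / a * R\<^sup>2"
        using a by (simp add: field_simps)
    qed
  qed (use C a in auto)
qed

text \<open>Each of \<open>J\<close> disjoint blocks of times adds the same multiple of the squared
  radius to the occupation sum, while the upper bound does not grow with \<open>J\<close>. The order
  of choices matters: first \<open>J\<close>, then \<open>\<epsilon>\<close>, and the radius
  last.\<close>

lemma small_ball_lower_bound_contradiction:
  fixes W :: "nat \<Rightarrow> 'a \<Rightarrow> real"
  assumes W [measurable]: "\<And>n. W n \<in> borel_measurable M"
    and "0 \<le> C"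
    and upper: "\<forall>\<epsilon>>0. \<exists>K. \<forall>R\<ge>K. \<forall>I. finite I \<longrightarrow>
      (\<Sum>n\<in>I. prob {x \<in> space M. W n x \<le> R} - \<epsilon>) \<le> C * R\<^sup>2"
    and c: "0 < c"
    and lower: "\<And>\<eta>. 0 < \<eta> \<Longrightarrow> \<eta> < 1 \<Longrightarrow>
      \<forall>\<^sub>F n in sequentially. c * \<eta>\<^sup>2 \<le> prob {x \<in> space M. W n x \<le> \<eta> * sqrt (real n)}"
  shows False
proof -
  \<comment> \<open>A block contains \<open>3 * 4 ^ j * r\<^sup>2\<close> times, each contributing
    at least \<open>c / 2 / 4 ^ Suc j\<close>; the product is
    \<open>3 * c / 8 * r\<^sup>2\<close>.\<close>
  obtain J :: nat where J: "C / (3 * c / 8) < real J" using reals_Archimedean2 by blast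
  \<comment> \<open>Half of the smallest lower bound \<open>c / 4 ^ Suc j\<close> over
    \<open>j < J\<close>, so that at least half of each bound survives the subtraction.\<close>
  define \<epsilon> where "\<epsilon> = c / 2 / 4 ^ J"
  have "0 < \<epsilon>" using c by (simp add: \<epsilon>_def)
  then obtain K where K: "\<And>R I. K \<le> R \<Longrightarrow> finite I \<Longrightarrow>
      (\<Sum>n\<in>I. prob {x \<in> space M. W n x \<le> R} - \<epsilon>) \<le> C * R\<^sup>2"
    using upper[rule_format, of \<epsilon>] by auto
  have "\<forall>\<^sub>F n in sequentially. \<forall>j\<in>{..<J}. c * ((1 / 2) ^ Suc j)\<^sup>2
      \<le> prob {x \<in> space M. W n x \<le> (1 / 2) ^ Suc j * sqrt (real n)}"
  proof (intro eventually_ball_finite ballI lower)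
    fix j show "(1 / 2 :: real) ^ Suc j < 1" by (rule power_Suc_less_one) auto
  qed auto
  then obtain n0 where n0': "\<forall>n\<ge>n0. \<forall>j\<in>{..<J}. c * ((1 / 2) ^ Suc j)\<^sup>2
      \<le> prob {x \<in> space M. W n x \<le> (1 / 2) ^ Suc j * sqrt (real n)}"
    unfolding eventually_sequentially by (rule exE)
  have n0: "c * ((1 / 2) ^ Suc j)\<^sup>2
      \<le> prob {x \<in> space M. W n x \<le> (1 / 2) ^ Suc j * sqrt (real n)}" if "n0 \<le> n" "j < J" for n j
    using n0'[rule_format, of n j] that unfolding lessThan_iff .
  \<comment> \<open>A natural radius gives blocks with integer endpoints. It exceeds
    \<open>K\<close> for the upper bound, and \<open>n0 \<le> r\<^sup>2\<close> puts every block in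
    the range of the lower bound.\<close>
  define r where "r = max (nat \<lceil>K\<rceil>) (Suc n0)"
  have r: "K \<le> real r" "0 < r" "n0 \<le> r\<^sup>2"
  proof -
    show "K \<le> real r" unfolding r_def by linarith
    show "0 < r" by (simp add: r_def)
    have "n0 \<le> r" by (simp add: r_def)
    also have "r \<le> r\<^sup>2" using \<open>0 < r\<close> by (simp add: power2_eq_square)
    finally show "n0 \<le> r\<^sup>2" .
  qed
  define A where "A j = {4 ^ j * r\<^sup>2 <.. 4 ^ Suc j * r\<^sup>2}" for j
  have block: "3 * c / 8 * (real r)\<^sup>2 \<le> (\<Sum>n\<in>A j. prob {x \<in> space M. W n x \<le> real r} - \<epsilon>)"
    if j: "j < J" for j
  proof -
    have "c / 2 / 4 ^ Suc j \<le> prob {x \<in> space M. W n x \<le> real r} - \<epsilon>" if n: "n \<in> A j" for n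
    proof -
      have "r\<^sup>2 \<le> 4 ^ j * r\<^sup>2" by simp
      then have "n0 \<le> n" using n r(3) unfolding A_def greaterThanAtMost_iff by linarith
      have "real n \<le> (2 ^ Suc j * real r)\<^sup>2"
      proof -
        have "real n \<le> real (4 ^ Suc j * r\<^sup>2)" using n unfolding A_def by (simp del: of_nat_mult of_nat_power)
        also have "\<dots> = (2 ^ Suc j * real r)\<^sup>2"
        proof -
          have "((2::real) ^ Suc j)\<^sup>2 = 4 ^ Suc j"
            by (simp only: power_mult[symmetric] mult.commute[of _ 2]) (simp add: power_mult)
          then show ?thesis by (simp add: power_mult_distrib)
        qed
        finally show ?thesis .
      qed
      then have "sqrt (real n) \<le> 2 ^ Suc j * real r" by (intro real_le_lsqrt) auto
      then have "(1 / 2) ^ Suc j * sqrt (real n) \<le> (1 / 2) ^ Suc j * (2 ^ Suc j * real r)"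
        by (rule mult_left_mono) simp
      also have "\<dots> = real r" by (simp add: power_one_over)
      finally have sq: "(1 / 2) ^ Suc j * sqrt (real n) \<le> real r" .
      have "c / 4 ^ Suc j = c * ((1 / 2) ^ Suc j)\<^sup>2"
      proof -
        have "((1 / 2 :: real) ^ Suc j)\<^sup>2 = (1 / 4) ^ Suc j"
          by (simp only: power_mult[symmetric] mult.commute[of _ 2]) (simp add: power_mult power2_eq_square)
        then show ?thesis by (simp add: power_one_over)
      qed
      also have "\<dots> \<le> prob {x \<in> space M. W n x \<le> (1 / 2) ^ Suc j * sqrt (real n)}"
        by (rule n0[OF \<open>n0 \<le> n\<close> j])
      also have "\<dots> \<le> prob {x \<in> space M. W n x \<le> real r}"
        using sq by (intro finite_measure_mono) auto
      finally have "c / 4 ^ Suc j \<le> prob {x \<in> space M. W n x \<le> real r}" .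
      moreover have "\<epsilon> \<le> c / 2 / 4 ^ Suc j"
        unfolding \<epsilon>_def using c j by (intro divide_left_mono power_increasing) auto
      moreover have "c / 2 / 4 ^ Suc j = c / 4 ^ Suc j / 2" by simp
      ultimately show ?thesis by linarith
    qed
    then have "real (card (A j)) * (c / 2 / 4 ^ Suc j)
        \<le> (\<Sum>n\<in>A j. prob {x \<in> space M. W n x \<le> real r} - \<epsilon>)"
      by (rule sum_bounded_below)
    moreover have "real (card (A j)) * (c / 2 / 4 ^ Suc j) = 3 * c / 8 * (real r)\<^sup>2"
    proof -
      have "card (A j) = 3 * (4 ^ j * r\<^sup>2)" by (simp add: A_def)
      then have "real (card (A j)) = 4 ^ j * (3 * (real r)\<^sup>2)" by simp
      then show ?thesis by simp
    qed
    ultimately show ?thesis by (simp only:)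
  qed
  have disj: "A i \<inter> A j = {}" if "i < j" for i j
  proof -
    have "(4::nat) ^ Suc i \<le> 4 ^ j" using that by (intro power_increasing) auto
    then have "4 ^ Suc i * r\<^sup>2 \<le> 4 ^ j * r\<^sup>2" by (rule mult_right_mono) simp
    then show ?thesis unfolding A_def by auto
  qed
  have "real J * (3 * c / 8 * (real r)\<^sup>2) = (\<Sum>j<J. 3 * c / 8 * (real r)\<^sup>2)" by simp
  also have "\<dots> \<le> (\<Sum>j<J. \<Sum>n\<in>A j. prob {x \<in> space M. W n x \<le> real r} - \<epsilon>)"
    by (intro sum_mono block) simp
  also have "\<dots> = (\<Sum>n\<in>(\<Union>j<J. A j). prob {x \<in> space M. W n x \<le> real r} - \<epsilon>)"
  proof (rule sum.UNION_disjoint[symmetric])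
    show "\<forall>i\<in>{..<J}. \<forall>j\<in>{..<J}. i \<noteq> j \<longrightarrow> A i \<inter> A j = {}"
      using disj by (metis Int_commute linorder_neqE_nat)
  qed (auto simp: A_def)
  also have "\<dots> \<le> C * (real r)\<^sup>2" using r by (intro K) (auto simp: A_def)
  finally have "real J * (3 * c / 8) \<le> C" using r(2) by simp
  then show False using J c by (simp add: field_simps)
qed

end

section \<open>Passage to the path space\<close>

context measure_preserving
begin

lemma measure_preserving_factor:
  assumes [measurable]: "\<pi> \<in> measurable M M'" "S \<in> measurable M' M'"
    and law: "distr M M' \<pi> = M'" and equivariant: "\<And>x. x \<in> space M \<Longrightarrow> \<pi> (T x) = S (\<pi> x)"
  shows "measure_preserving M' S"
proof -
  have "prob_space M'"
    using prob_space_distr[OF assms(1)] by (simp add: law)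
  moreover have "distr M' M' S = M'"
  proof -
    have "distr M' M' S = distr (distr M M' \<pi>) M' S" by (simp only: law)
    also have "\<dots> = distr M M' (S \<circ> \<pi>)" by (rule distr_distr) measurable
    also have "\<dots> = distr M M' (\<pi> \<circ> T)" by (rule distr_cong) (auto simp: equivariant)
    also have "\<dots> = distr (distr M M T) M' \<pi>" by (rule distr_distr[symmetric]) measurable
    also have "\<dots> = M'" by (simp only: distr_T law)
    finally show ?thesis .
  qed
  ultimately show ?thesis
    by (simp add: measure_preserving_def measure_preserving_axioms_def assms)
qed

text \<open>The function \<open>h\<close> plays the role of the conditional expectation of \<open>B\<close> given the factor. It
  lives on the factor, where ergodicity is available, whereas \<open>T\<close> itself need not be ergodic.\<close>

lemma factor_density:
  assumes [measurable]: "\<pi> \<in> measurable M M'" "S \<in> measurable M' M'" "S' \<in> measurable M' M'" "B \<in> sets M"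
    and law: "distr M M' \<pi> = M'" and equivariant: "\<And>x. x \<in> space M \<Longrightarrow> \<pi> (T x) = S (\<pi> x)"
    and inverse: "\<And>u. u \<in> space M' \<Longrightarrow> S' (S u) = u"
    and B: "0 < prob B"
  shows "\<exists>h\<in>borel_measurable M'. (\<forall>u. 0 \<le> h u \<and> h u \<le> (1::real)) \<and> 0 < (\<integral>u. h u \<partial>M') \<and>
    (\<forall>n. \<forall>A\<in>sets M'. (\<integral>u. h ((S ^^ n) u) * indicator A u \<partial>M')
       \<le> prob {x \<in> space M. (T ^^ n) x \<in> B \<and> \<pi> x \<in> A})"
proof -
  interpret F: measure_preserving M' S
    by (rule measure_preserving_factor) (use assms in auto)
  \<comment> \<open>The image under \<open>\<pi>\<close> of the measure restricted to
    \<open>B\<close>. Its density with respect to \<open>M'\<close> is the conditional probability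
    of \<open>B\<close> given the factor.\<close>
  define \<rho> where "\<rho> = distr (density M (indicator B)) M' \<pi>"
  have \<rho>: "emeasure \<rho> A = emeasure M (B \<inter> (\<pi> -` A \<inter> space M))" if [measurable]: "A \<in> sets M'" for A
  proof -
    have "emeasure \<rho> A = emeasure (density M (indicator B)) (\<pi> -` A \<inter> space M)"
      by (simp add: \<rho>_def emeasure_distr)
    also have "\<dots> = (\<integral>\<^sup>+x. indicator B x * indicator (\<pi> -` A \<inter> space M) x \<partial>M)"
      by (rule emeasure_density) measurable
    also have "\<dots> = (\<integral>\<^sup>+x. indicator (B \<inter> (\<pi> -` A \<inter> space M)) x \<partial>M)"
      by (rule nn_integral_cong) (auto simp: indicator_def)
    also have "\<dots> = emeasure M (B \<inter> (\<pi> -` A \<inter> space M))"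
      by (rule nn_integral_indicator) measurable
    finally show ?thesis .
  qed
  have sets_\<rho>: "sets \<rho> = sets M'" by (simp add: \<rho>_def)
  have "absolutely_continuous M' \<rho>"
    unfolding absolutely_continuous_def
  proof
    fix A assume A: "A \<in> null_sets M'"
    then have [measurable]: "A \<in> sets M'" by auto
    have "emeasure M (\<pi> -` A \<inter> space M) = emeasure (distr M M' \<pi>) A"
      by (simp add: emeasure_distr)
    also have "\<dots> = 0" using A by (simp add: law null_setsD1)
    finally have 0: "emeasure M (\<pi> -` A \<inter> space M) = 0" .
    have "emeasure M (B \<inter> (\<pi> -` A \<inter> space M)) \<le> emeasure M (\<pi> -` A \<inter> space M)"
      by (rule emeasure_mono) auto
    then have "emeasure \<rho> A = 0" by (simp add: \<rho> 0)
    then show "A \<in> null_sets \<rho>" by (simp add: null_sets_def sets_\<rho>)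
  qed
  from F.Radon_Nikodym[OF this sets_\<rho>]
  obtain h0 where h0 [measurable]: "h0 \<in> borel_measurable M'" and density: "density M' h0 = \<rho>" by auto
  \<comment> \<open>Truncation at 1 gives the bound at every point. It can only lower the integrals,
    which is the direction wanted, and it keeps the set where the density vanishes.\<close>
  define h where "h u = enn2real (min 1 (h0 u))" for u
  have [measurable]: "h \<in> borel_measurable M'" unfolding h_def[abs_def] by measurable
  have ennreal_h: "ennreal (h u) = min 1 (h0 u)" for u
    unfolding h_def by (rule ennreal_enn2real) (simp add: min_less_iff_disj)
  have h01: "0 \<le> h u \<and> h u \<le> 1" for u
  proof -
    have "ennreal (h u) \<le> ennreal 1" unfolding ennreal_h by simp
    then show ?thesis by (simp add: h_def)
  qed
  have h_int: "integrable M' h" by (rule F.integrable_const_bound[of _ 1]) (use h01 in auto)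
  have "(\<integral>u. h u \<partial>M') \<noteq> 0"
  proof
    assume "(\<integral>u. h u \<partial>M') = 0"
    then have "AE u in M'. h u = 0"
      using h_int h01 by (subst (asm) integral_nonneg_eq_0_iff_AE) auto
    then have "AE u in M'. h0 u = 0"
    proof eventually_elim
      case (elim u)
      then have "min 1 (h0 u) = 0" using ennreal_h[of u] by simp
      then show ?case by (auto simp: min_def split: if_splits)
    qed
    then have "(\<integral>\<^sup>+u. h0 u * indicator (space M') u \<partial>M') = (\<integral>\<^sup>+u. 0 \<partial>M')"
      by (intro nn_integral_cong_AE) auto
    then have "emeasure (density M' h0) (space M') = 0" by (simp add: emeasure_density)
    moreover have "B \<inter> (\<pi> -` space M' \<inter> space M) = B"
      using sets.sets_into_space[OF \<open>B \<in> sets M\<close>] measurable_space[OF assms(1)] by auto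
    ultimately have "emeasure M B = 0" by (simp add: density \<rho>)
    then show False using B by (simp add: measure_def)
  qed
  moreover have "0 \<le> (\<integral>u. h u \<partial>M')" using h01 by simp
  ultimately have pos: "0 < (\<integral>u. h u \<partial>M')" by simp
  note S'_funpow = measurable_funpow[OF assms(3)]
  have inverse_funpow: "(S' ^^ n) ((S ^^ n) u) = u" if "u \<in> space M'" for n u
  proof (induction n)
    case (Suc n)
    have "(S' ^^ Suc n) ((S ^^ Suc n) u) = (S' ^^ n) (S' (S ((S ^^ n) u)))"
      by (simp only: funpow_Suc_right[of n S'] funpow.simps(2)[of n S] comp_apply)
    then show ?case using Suc inverse[OF F.funpow_in_space[OF that]] by simp
  qed simp
  have equivariant_funpow: "\<pi> ((T ^^ n) x) = (S ^^ n) (\<pi> x)" if "x \<in> space M" for n x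
    by (induction n) (simp_all add: equivariant funpow_in_space that)
  have "(\<integral>u. h ((S ^^ n) u) * indicator A u \<partial>M')
       \<le> prob {x \<in> space M. (T ^^ n) x \<in> B \<and> \<pi> x \<in> A}"
    if [measurable]: "A \<in> sets M'" for n A
  proof -
    \<comment> \<open>Since \<open>S'\<close> undoes \<open>S\<close>, membership of
      \<open>u\<close> in \<open>A\<close> is membership of \<open>(S ^^ n) u\<close> in
      \<open>A'\<close>. The integrand is then a function of the \<open>n\<close>-th iterate, and
      invariance removes \<open>n\<close>.\<close>
    define A' where "A' = (S' ^^ n) -` A \<inter> space M'"
    have [measurable]: "A' \<in> sets M'"
      unfolding A'_def by (rule measurable_sets[OF S'_funpow that])
    have A': "(S ^^ n) u \<in> A' \<longleftrightarrow> u \<in> A" if "u \<in> space M'" for u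
      using inverse_funpow[OF that] F.funpow_in_space[OF that] by (simp add: A'_def)
    have "ennreal (\<integral>u. h ((S ^^ n) u) * indicator A u \<partial>M')
        = (\<integral>\<^sup>+u. ennreal (h ((S ^^ n) u) * indicator A u) \<partial>M')"
      by (rule nn_integral_eq_integral[symmetric])
        (use h01 in \<open>auto intro!: F.integrable_const_bound[of _ 1] simp: indicator_def\<close>)
    also have "\<dots> = (\<integral>\<^sup>+u. min 1 (h0 ((S ^^ n) u)) * indicator A' ((S ^^ n) u) \<partial>M')"
      by (rule nn_integral_cong) (simp add: A' ennreal_h indicator_def)
    also have "\<dots> = (\<integral>\<^sup>+u. min 1 (h0 u) * indicator A' u \<partial>M')"
      by (rule F.nn_integral_funpow) measurable
    also have "\<dots> \<le> (\<integral>\<^sup>+u. h0 u * indicator A' u \<partial>M')"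
      by (intro nn_integral_mono mult_right_mono) auto
    also have "\<dots> = emeasure \<rho> A'" by (simp add: density[symmetric] emeasure_density)
    also have "\<dots> = emeasure M (B \<inter> (\<pi> -` A' \<inter> space M))" by (rule \<rho>) simp
    also have "\<dots> = prob (B \<inter> (\<pi> -` A' \<inter> space M))" by (rule emeasure_eq_measure)
    also have "\<dots> = prob {x \<in> space M. (T ^^ n) x \<in> B \<inter> (\<pi> -` A' \<inter> space M)}"
      by (subst prob_funpow) measurable
    also have "{x \<in> space M. (T ^^ n) x \<in> B \<inter> (\<pi> -` A' \<inter> space M)}
        = {x \<in> space M. (T ^^ n) x \<in> B \<and> \<pi> x \<in> A}"
      using A' measurable_space[OF assms(1)] funpow_in_space by (auto simp: equivariant_funpow)
    finally show ?thesis by simp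
  qed
  with pos h01 show ?thesis by (intro bexI[of _ h]) auto
qed

end

text \<open>Needed for the orbit map to intertwine \<open>T\<close> with the shift. The case
  \<open>k = - 1\<close> is separate because the right-hand side then leaves the branch of the
  inverse.\<close>

lemma int_iter_Suc:
  assumes "bij_betw T (space M) (space M)" "x \<in> space M"
  shows "int_iter M T k (T x) = int_iter M T (k + 1) x"
proof (cases "0 \<le> k")
  case True
  then show ?thesis by (simp add: int_iter_def nat_add_distrib funpow_swap1)
next
  case False
  define n where "n = nat (- (k + 1))"
  have n: "nat (- k) = Suc n" using False by (simp add: n_def)
  have "the_inv_into (space M) T (T x) = x"
    using assms by (simp add: the_inv_into_f_f bij_betw_def)
  then have "int_iter M T k (T x) = (the_inv_into (space M) T ^^ n) x"
    using False by (simp add: int_iter_def n funpow_swap1)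
  also have "\<dots> = int_iter M T (k + 1) x"
  proof (cases "k = - 1")
    case True
    then show ?thesis by (simp add: int_iter_def n_def)
  next
    case False2: False
    then show ?thesis using False by (simp add: int_iter_def n_def)
  qed
  finally show ?thesis .
qed

section \<open>From failure of recurrence to a counting bound\<close>

lemma measurable_motion_borelD: "f \<in> measurable M motion_borel \<Longrightarrow> f \<in> borel_measurable M"
  by (simp add: measurable_restrict_space2_iff)

lemma motion_neighbourhood_of_one:
  assumes "openin motion_top U" "\<one>\<^bsub>motion_group\<^esub> \<in> U"
  obtains \<delta> where "0 < \<delta>"
    "\<And>p. p \<in> carrier motion_group \<Longrightarrow> cmod (fst p) < \<delta> \<Longrightarrow> cmod (snd p - 1) < \<delta> \<Longrightarrow> p \<in> U"
proof -
  have "(0, 1) \<in> U" using assms(2) by simp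
  then obtain e where e: "0 < e" "ball (0, 1) e \<inter> carrier motion_group \<subseteq> U"
    using assms(1) unfolding openin_contains_ball by blast
  show thesis
  proof (rule that[of "e / 2"])
    fix p assume p: "p \<in> carrier motion_group" "cmod (fst p) < e / 2" "cmod (snd p - 1) < e / 2"
    have "dist (0, 1) p \<le> cmod (fst p) + cmod (snd p - 1)"
      using sqrt_sum_squares_le_sum_abs[of "cmod (fst p)" "cmod (snd p - 1)"]
      by (simp add: dist_prod_def dist_norm norm_minus_commute)
    then have "p \<in> ball (0, 1) e" using p by simp
    then show "p \<in> U" using p e by auto
  qed (use e in simp)
qed

lemma walk_in_carrier:
  "(\<And>k. z k \<in> carrier motion_group) \<Longrightarrow> walk z n \<in> carrier motion_group"
  using norm_snd_walk[of z n] by (simp add: motion_group_def mem_Times_iff)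

text \<open>Failure of recurrence says that each return event is null. Deleting the countably many
  events of positive time from \<open>B\<close> keeps its measure and excludes returns at every
  remaining point, so the packing bound holds along every orbit.\<close>

lemma nonreturning_set:
  fixes N :: "'x measure" and f :: "'x \<Rightarrow> complex \<times> complex"
  assumes "measure_preserving N T" and f: "f \<in> measurable N motion_borel"
    and "\<not> recurrent N T f"
  obtains B C where "B \<in> sets N" "0 < measure N B"
    "\<And>x R I. x \<in> space N \<Longrightarrow> 1 \<le> R \<Longrightarrow> finite I \<Longrightarrow>
      real (card {n \<in> I. (T ^^ n) x \<in> B \<and> cmod (fst (walk (\<lambda>k. f ((T ^^ k) x)) n)) \<le> R}) \<le> C * R\<^sup>2"
proof -
  interpret measure_preserving N T by fact
  obtain B U where [measurable]: "B \<in> sets N" and B: "0 < prob B"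
    and U: "openin motion_top U" "\<one>\<^bsub>motion_group\<^esub> \<in> U"
    and null: "\<And>n. n \<noteq> 0 \<Longrightarrow>
      \<not> 0 < prob {x \<in> space N. x \<in> B \<and> int_iter N T n x \<in> B \<and> cocycle N T f n x \<in> U}"
    using assms(3) unfolding recurrent_def by blast
  obtain \<delta> where \<delta>: "0 < \<delta>"
    "\<And>p. p \<in> carrier motion_group \<Longrightarrow> cmod (fst p) < \<delta> \<Longrightarrow> cmod (snd p - 1) < \<delta> \<Longrightarrow> p \<in> U"
    by (rule motion_neighbourhood_of_one[OF U]) (blast intro: that)
  define w where "w n x = walk (\<lambda>k. f ((T ^^ k) x)) n" for n x
  have [measurable]: "f \<in> borel_measurable N" using f by (rule measurable_motion_borelD)
  have [measurable]: "w n \<in> borel_measurable N" for n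
    unfolding w_def[abs_def] by (rule measurable_walk) measurable
  have f_carrier: "f ((T ^^ k) x) \<in> carrier motion_group" if "x \<in> space N" for k x
    using measurable_space[OF f funpow_in_space[OF that, of k]] by (simp add: space_restrict_space)
  have w_carrier: "w n x \<in> carrier motion_group" if "x \<in> space N" for n x
    unfolding w_def using f_carrier[OF that] by (rule walk_in_carrier)
  obtain V where V: "open V" "U = carrier motion_group \<inter> V"
    using U(1) by (auto simp: openin_open)
  then have [measurable]: "V \<in> sets borel" by simp
  \<comment> \<open>Stated with the open set \<open>V\<close>, which is Borel in the ambient space;
    as the walk stays in the group, this agrees with \<open>U\<close>.\<close>
  define E where "E n = {x \<in> space N. x \<in> B \<and> (T ^^ n) x \<in> B \<and> w n x \<in> V}" for n
  have E [measurable]: "E n \<in> sets N" for n unfolding E_def by measurable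
  have "prob (E (Suc n)) = 0" for n
  proof -
    have "{x \<in> space N. x \<in> B \<and> int_iter N T (int (Suc n)) x \<in> B \<and> cocycle N T f (int (Suc n)) x \<in> U}
        = {x \<in> space N. x \<in> B \<and> (T ^^ Suc n) x \<in> B \<and> w (Suc n) x \<in> U}"
      unfolding int_iter_def cocycle_def w_def by (simp only: nat_int of_nat_0_le_iff if_True)
    also have "\<dots> = E (Suc n)" using w_carrier by (auto simp: E_def V(2) simp del: funpow.simps)
    finally show ?thesis using null[of "int (Suc n)"] by (simp add: zero_less_measure_iff)
  qed
  then have "E (Suc n) \<in> null_sets N" for n by (simp add: null_sets_def emeasure_eq_measure)
  then have null_UN: "(\<Union>n. E (Suc n)) \<in> null_sets N" by auto
  define B' where "B' = B - (\<Union>n. E (Suc n))"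
  show thesis
  proof (rule that[of B' "(4 / \<delta> + 2) ^ 4"])
    show "B' \<in> sets N" unfolding B'_def by measurable
    show "0 < prob B'" using B measure_Diff_null_set[OF \<open>B \<in> sets N\<close> null_UN] by (simp add: B'_def)
  next
    fix x and R :: real and I :: "nat set" assume x: "x \<in> space N" and "1 \<le> R" "finite I"
    let ?I = "{n \<in> I. (T ^^ n) x \<in> B' \<and> cmod (fst (walk (\<lambda>k. f ((T ^^ k) x)) n)) \<le> R}"
    show "real (card ?I) \<le> (4 / \<delta> + 2) ^ 4 * R\<^sup>2"
    proof (rule card_nonreturning_le[where z = "\<lambda>k. f ((T ^^ k) x)"])
      fix m n assume mn: "m \<in> ?I" "n \<in> ?I" "m < n"
      define y where "y = (T ^^ m) x"
      have y: "y \<in> space N" unfolding y_def by (rule funpow_in_space[OF x])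
      obtain k where k: "n - m = Suc k" using mn(3) by (metis Suc_diff_Suc)
      have "(T ^^ (n - m)) y = (T ^^ (n - m + m)) x" by (simp only: y_def funpow_add comp_apply)
      then have "(T ^^ (n - m)) y \<in> B" using mn by (simp add: B'_def)
      \<comment> \<open>The deleted events are indexed by \<open>Suc k\<close>, hence the need for
        \<open>n - m\<close> to be positive.\<close>
      moreover have "y \<in> B" "y \<notin> E (n - m)" using mn(1) k by (auto simp: y_def B'_def simp del: funpow.simps)
      ultimately have "w (n - m) y \<notin> V" using y by (auto simp: E_def)
      then have "w (n - m) y \<notin> U" using V(2) by simp
      then have "\<delta> \<le> cmod (fst (w (n - m) y)) \<or> \<delta> \<le> cmod (snd (w (n - m) y) - 1)"
        using \<delta>(2)[OF w_carrier[OF y]] by (meson not_less)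
      moreover have "w (n - m) y = walk (\<lambda>k. f ((T ^^ (m + k)) x)) (n - m)"
        unfolding w_def y_def by (simp add: add.commute[of m] funpow_add)
      ultimately show "\<delta> \<le> cmod (fst (walk (\<lambda>k. f ((T ^^ (m + k)) x)) (n - m))) \<or>
          \<delta> \<le> cmod (snd (walk (\<lambda>k. f ((T ^^ (m + k)) x)) (n - m)) - 1)"
        by simp
    qed (use f_carrier[OF x] \<delta>(1) \<open>1 \<le> R\<close> \<open>finite I\<close> in auto)
  qed
qed

theorem theorem1p3:
  fixes P :: "'w measure" and Z :: "int \<Rightarrow> 'w \<Rightarrow> complex \<times> complex"
    and N :: "'x measure" and T :: "'x \<Rightarrow> 'x" and f :: "'x \<Rightarrow> complex \<times> complex"
    and c :: real
  assumes "motion_process P Z" "stationary_process P Z" "ergodic_process P Z"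
    and "c > 0"
    and "\<And>\<eta>::real. 0 < \<eta> \<Longrightarrow> \<eta> < 1 \<Longrightarrow>
           liminf (\<lambda>n. ereal (measure P {\<omega> \<in> space P.
              real n powr (- 1 / 2) * cmod (fst (walk (\<lambda>k. Z (int k) \<omega>) n)) \<le> \<eta>}))
           \<ge> ereal (c * \<eta>\<^sup>2)"
    and "realizes N T f P Z"
  shows "recurrent N T f"
proof (rule ccontr)
  assume not_recurrent: "\<not> recurrent N T f"
  let ?Q = "path_law P Z"
  have sets_Q [measurable_cong]: "sets ?Q = sets path_space" by (simp add: path_law_def)
  have space_Q: "space ?Q = space path_space" by (simp add: path_law_def)
  from \<open>realizes N T f P Z\<close>
  have N: "prob_space N" and bij: "bij_betw T (space N) (space N)"
    and T [measurable]: "T \<in> measurable N N" and T' [measurable]: "the_inv_into (space N) T \<in> measurable N N"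
    and "distr N N T = N" and f [measurable]: "f \<in> measurable N motion_borel"
    and law: "path_law N (\<lambda>k x. f (int_iter N T k x)) = ?Q"
    by (auto simp: realizes_def invertible_mpt_def standard_probability_space_def)
  then interpret N: measure_preserving N T
    by (simp add: measure_preserving_def measure_preserving_axioms_def)
  obtain B C where [measurable]: "B \<in> sets N" and B: "0 < N.prob B"
    and count: "\<And>x R I. x \<in> space N \<Longrightarrow> 1 \<le> R \<Longrightarrow> finite I \<Longrightarrow>
      real (card {n \<in> I. (T ^^ n) x \<in> B \<and> cmod (fst (walk (\<lambda>k. f ((T ^^ k) x)) n)) \<le> R}) \<le> C * R\<^sup>2"
    by (rule nonreturning_set[OF N.measure_preserving_axioms f not_recurrent]) (blast intro: that)

  \<comment> \<open>The orbit map as a factor map onto the path space\<close>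
  define \<pi> where "\<pi> x = (\<lambda>k. f (int_iter N T k x))" for x
  have iter [measurable]: "int_iter N T k \<in> measurable N N" for k
    unfolding int_iter_def using T' by (simp add: measurable_funpow)
  have fk: "(\<lambda>x. f (int_iter N T k x)) \<in> measurable N motion_borel" for k by measurable
  have \<pi>: "\<pi> \<in> measurable N path_space"
    unfolding \<pi>_def[abs_def]
  proof (rule measurable_PiM_single')
    show "(\<lambda>x k. f (int_iter N T k x)) \<in> space N \<rightarrow> (\<Pi>\<^sub>E k\<in>UNIV. space motion_borel)"
      using measurable_space[OF fk] by (auto simp: PiE_def)
  qed (rule fk)
  then have \<pi>_Q [measurable]: "\<pi> \<in> measurable N ?Q"
    using measurable_cong_sets[OF refl sets_Q] by blast
  have shift: "path_shift \<in> measurable ?Q ?Q" "path_unshift \<in> measurable ?Q ?Q"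
    using measurable_path_shift measurable_path_unshift measurable_cong_sets[OF sets_Q sets_Q] by auto
  have law': "distr N ?Q \<pi> = ?Q"
  proof -
    have "distr N ?Q \<pi> = distr N path_space \<pi>" by (rule distr_cong) (auto simp: sets_Q)
    also have "\<dots> = ?Q" using law by (simp add: path_law_def \<pi>_def[abs_def])
    finally show ?thesis .
  qed
  have equivariant: "\<pi> (T x) = path_shift (\<pi> x)" if "x \<in> space N" for x
    by (rule ext) (simp add: \<pi>_def path_shift_def int_iter_Suc[OF bij that])
  interpret Q: measure_preserving ?Q path_shift
    by (rule N.measure_preserving_factor[OF \<pi>_Q shift(1) law' equivariant])
  have unshift: "path_unshift (path_shift u) = u" for u :: "int \<Rightarrow> complex \<times> complex"
    by (simp add: path_shift_def path_unshift_def)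
  obtain h where h [measurable]: "h \<in> borel_measurable ?Q" and h01: "\<And>u. 0 \<le> h u \<and> h u \<le> (1::real)"
    and h_pos: "0 < (\<integral>u. h u \<partial>?Q)"
    and h_le: "\<And>n A. A \<in> sets ?Q \<Longrightarrow> (\<integral>u. h ((path_shift ^^ n) u) * indicator A u \<partial>?Q)
       \<le> N.prob {x \<in> space N. (T ^^ n) x \<in> B \<and> \<pi> x \<in> A}"
    using N.factor_density[OF \<pi>_Q shift \<open>B \<in> sets N\<close> law' equivariant unshift B] by blast

  \<comment> \<open>Upper bound for occupation times under the path law\<close>
  define W where "W n u = cmod (fst (walk (\<lambda>k. u (int k)) n))" for n and u :: "int \<Rightarrow> complex \<times> complex"
  have "(\<lambda>u. u k) \<in> borel_measurable ?Q" for k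
    by (rule measurable_motion_borelD) measurable
  then have walk: "(\<lambda>u. walk (\<lambda>k. u (int k)) n) \<in> measurable ?Q (borel \<Otimes>\<^sub>M borel)" for n
    unfolding borel_prod by (intro measurable_walk)
  have W [measurable]: "W n \<in> borel_measurable ?Q" for n
    unfolding W_def[abs_def] by (rule measurable_compose[OF measurable_fst'[OF walk] borel_measurable_norm])
  have shift_funpow: "(path_shift ^^ n) u = (\<lambda>k. u (int n + k))" for n and u :: "int \<Rightarrow> complex \<times> complex"
    by (induction n) (auto simp: path_shift_def algebra_simps)
  have subadd: "W (n + i) u \<le> W n u + W i ((path_shift ^^ n) u)" if "u \<in> space ?Q" for n i u
  proof -
    have "u k \<in> carrier motion_group" for k
      using that by (auto simp: space_Q space_path_space)
    then show ?thesis
      using cmod_fst_walk_add_le[of "\<lambda>k. u (int k)" n i] by (simp add: W_def shift_funpow)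
  qed
  have \<pi>_walk: "W n (\<pi> x) = cmod (fst (walk (\<lambda>k. f ((T ^^ k) x)) n))" for n x
    by (simp add: W_def \<pi>_def int_iter_def)
  have bound: "(\<Sum>n\<in>I. \<integral>u. h ((path_shift ^^ n) u) * of_bool (W n u \<le> R) \<partial>?Q) \<le> C * R\<^sup>2"
    if R: "1 \<le> R" and I: "finite I" for R I
  proof -
    define A where "A n = {x \<in> space N. (T ^^ n) x \<in> B \<and> W n (\<pi> x) \<le> R}" for n
    have A [measurable]: "A n \<in> sets N" for n unfolding A_def by measurable
    have "(\<Sum>n\<in>I. \<integral>u. h ((path_shift ^^ n) u) * of_bool (W n u \<le> R) \<partial>?Q) \<le> (\<Sum>n\<in>I. N.prob (A n))"
    proof (rule sum_mono)
      fix n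
      let ?A = "{u \<in> space ?Q. W n u \<le> R}"
      have "(\<integral>u. h ((path_shift ^^ n) u) * of_bool (W n u \<le> R) \<partial>?Q)
          = (\<integral>u. h ((path_shift ^^ n) u) * indicator ?A u \<partial>?Q)"
        by (rule Bochner_Integration.integral_cong) auto
      also have "\<dots> \<le> N.prob {x \<in> space N. (T ^^ n) x \<in> B \<and> \<pi> x \<in> ?A}"
        by (rule h_le) measurable
      also have "{x \<in> space N. (T ^^ n) x \<in> B \<and> \<pi> x \<in> ?A} = A n"
        using measurable_space[OF \<pi>_Q] by (auto simp: A_def)
      finally show "(\<integral>u. h ((path_shift ^^ n) u) * of_bool (W n u \<le> R) \<partial>?Q) \<le> N.prob (A n)" .
    qed
    \<comment> \<open>The sum of probabilities is the expected number of visits, and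
      \<open>count\<close> bounds that number at each point.\<close>
    also have "\<dots> = (\<integral>x. (\<Sum>n\<in>I. indicator (A n) x) \<partial>N)"
      by (subst Bochner_Integration.integral_sum) (auto simp: N.emeasure_eq_measure)
    also have "\<dots> \<le> (\<integral>x. C * R\<^sup>2 \<partial>N)"
    proof (rule integral_mono)
      fix x assume x: "x \<in> space N"
      have "(\<Sum>n\<in>I. indicator (A n) x) = (\<Sum>n\<in>I. of_bool (x \<in> A n) :: real)"
        by (intro sum.cong) auto
      also have "\<dots> = real (card {n \<in> I. x \<in> A n})"
        using I by (simp add: sum_of_bool_eq Int_def)
      also have "\<dots> \<le> C * R\<^sup>2"
        using count[OF x R I] x by (simp add: A_def \<pi>_walk)
      finally show "(\<Sum>n\<in>I. indicator (A n) x) \<le> C * R\<^sup>2" .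
    qed (auto simp: N.emeasure_eq_measure)
    finally show ?thesis by (simp add: N.prob_space)
  qed
  have ergodic: "Q.prob A \<in> {0, 1}" if "A \<in> sets ?Q" "path_shift -` A \<inter> space ?Q = A" for A
    using \<open>ergodic_process P Z\<close> that by (simp add: ergodic_process_def sets_Q space_Q)
  obtain C' where C': "0 \<le> C'" "\<forall>\<epsilon>>0. \<exists>K. \<forall>R\<ge>K. \<forall>I. finite I \<longrightarrow>
      (\<Sum>n\<in>I. Q.prob {u \<in> space ?Q. W n u \<le> R} - \<epsilon>) \<le> C' * R\<^sup>2"
    using Q.occupation_bound[OF ergodic W subadd h h01 h_pos bound] by auto

  \<comment> \<open>Lower bound for small displacements under the path law\<close>
  have Zm: "Z k \<in> measurable P motion_borel" for k
    using \<open>motion_process P Z\<close> by (simp add: motion_process_def)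
  have paths: "(\<lambda>\<omega> k. Z k \<omega>) \<in> measurable P path_space"
  proof (rule measurable_PiM_single')
    show "(\<lambda>\<omega> k. Z k \<omega>) \<in> space P \<rightarrow> (\<Pi>\<^sub>E k\<in>UNIV. space motion_borel)"
      using measurable_space[OF Zm] by (auto simp: PiE_def)
  qed (rule Zm)
  have lower: "\<forall>\<^sub>F n in sequentially. c / 2 * \<eta>\<^sup>2 \<le> Q.prob {u \<in> space ?Q. W n u \<le> \<eta> * sqrt (real n)}"
    if \<eta>: "0 < \<eta>" "\<eta> < 1" for \<eta>
  proof -
    \<comment> \<open>A bound on the lower limit yields an eventual bound only for a strictly
      smaller constant, hence \<open>c / 2\<close>.\<close>
    have "ereal (c / 2 * \<eta>\<^sup>2) < ereal (c * \<eta>\<^sup>2)" using \<open>c > 0\<close> \<eta> by simp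
    also note assms(5)[OF \<eta>]
    finally have "\<forall>\<^sub>F n in sequentially. ereal (c / 2 * \<eta>\<^sup>2) < ereal (measure P {\<omega> \<in> space P.
        real n powr (- 1 / 2) * cmod (fst (walk (\<lambda>k. Z (int k) \<omega>) n)) \<le> \<eta>})"
      by (rule less_LiminfD)
    then show ?thesis
      using eventually_gt_at_top[of 0]
    proof eventually_elim
      case (elim n)
      have scale: "real n powr (- 1 / 2) * t \<le> \<eta> \<longleftrightarrow> t \<le> \<eta> * sqrt (real n)" for t
      proof -
        have "real n powr (- 1 / 2) = 1 / sqrt (real n)"
          using powr_minus_divide[of "real n" "1 / 2"] by (simp add: powr_half_sqrt)
        then have "real n powr (- 1 / 2) * t = t / sqrt (real n)" by (simp only: times_divide_eq_left mult_1)
        then show ?thesis using elim(2) by (simp only:) (simp add: pos_divide_le_eq)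
      qed
      have "{u \<in> space ?Q. W n u \<le> \<eta> * sqrt (real n)} \<in> sets path_space"
        unfolding sets_Q[symmetric] by measurable
      then have "Q.prob {u \<in> space ?Q. W n u \<le> \<eta> * sqrt (real n)}
          = measure P ((\<lambda>\<omega> k. Z k \<omega>) -` {u \<in> space ?Q. W n u \<le> \<eta> * sqrt (real n)} \<inter> space P)"
        unfolding path_law_def by (intro measure_distr paths) simp
      also have "(\<lambda>\<omega> k. Z k \<omega>) -` {u \<in> space ?Q. W n u \<le> \<eta> * sqrt (real n)} \<inter> space P
          = {\<omega> \<in> space P. real n powr (- 1 / 2) * cmod (fst (walk (\<lambda>k. Z (int k) \<omega>) n)) \<le> \<eta>}"
        using measurable_space[OF paths] unfolding scale by (auto simp: W_def space_Q)
      finally show ?case using elim(1) by simp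
    qed
  qed
  show False
    by (rule Q.small_ball_lower_bound_contradiction[OF W C' _ lower]) (use \<open>c > 0\<close> in auto)
qed

end
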